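(* Let $F_N$ be the free group of finite rank $N\ge2$. The set $\Lambda_{\mathrm{rat}}$ of rational laminations is not dense in the space $\Lambda^2(F_N)$ of algebraic laminations. However, the closure $\overline{\Lambda}_{\mathrm{rat}}$ of $\Lambda_{\mathrm{rat}}$ in $\Lambda^2(F_N)$ contains all minimal algebraic laminations.
   Context: Given a basis $\mathcal A$ of $F_N$, the Gromov boundary $\partial F_N$ is identified with the set of one-sided infinite reduced words $x_1x_2x_3\ldots$ in $\mathcal A^{\pm1}=\mathcal A\cup\mathcal A^{-1}$; $X_n$ denotes the prefix of length $n$ of $X$. It carries the metric $d_{\mathcal A}(X,Y)=\exp(-\max\{n\ge0 : X_n=Y_n\})$ (equal to $0$ if $X=Y$) and the left action of $F_N$. Set $\partial^2F_N=(\partial F_N\times\partial F_N)\smallsetminus\Delta$, where $\Delta$ is the diagonal, with the action $w(X,Y)=(wX,wY)$ and the flip $(X,Y)\mapsto(Y,X)$. An algebraic lamination is a non-empty closed, flip-invariant, $F_N$-invariant subset of $\partial^2F_N$; $\Lambda^2(F_N)$ is the set of all of them. Its topology is induced by the Hausdorff distance between subsets of $\partial^2F_N$ with respect to the metric $\max(d_{\mathcal A}(X,X'),d_{\mathcal A}(Y,Y'))$; this topology does not depend on $\mathcal A$. For $w\in F_N\smallsetminus\{1\}$, let $w^{+\infty}$ and $w^{-\infty}$ be the limits in $\partial F_N$ of $(w^n)_{n\in\mathbb N}$ and $(w^{-n})_{n\in\mathbb N}$, and let $$L(w)=\{(vw^{-\infty},vw^{+\infty}) : v\in F_N\}\cup\{(vw^{+\infty},vw^{-\infty})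 : v\in F_N\}.$$ A rational lamination is a finite (non-empty) union of laminations $L(w)$; $\Lambda_{\mathrm{rat}}\subset\Lambda^2(F_N)$ is the set of all rational laminations. An algebraic lamination is minimal if it is minimal with respect to inclusion among algebraic laminations, i.e. it contains no algebraic lamination as a proper subset. *)

theory Defs
  imports "HOL-Algebra.Group" "HOL-Analysis.Analysis"
begin

section \<open>The free group on a set\<close>

text \<open>The letter \<open>(a, True)\<close> stands for the basis element \<open>a\<close>, and \<open>(a, False)\<close> for
  its inverse.\<close>

type_synonym 'a letter = "'a \<times> bool"

definition inv_letter :: "'a letter \<Rightarrow> 'a letter" where
  "inv_letter x = (fst x, \<not> snd x)"

definition reduced :: "'a letter list \<Rightarrow> bool" where
  "reduced w \<longleftrightarrow> successively (\<lambda>x y. y \<noteq> inv_letter x) w"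

text \<open>Left multiplication of a reduced word by one letter, followed by free reduction.\<close>

definition lcons :: "'a letter \<Rightarrow> 'a letter list \<Rightarrow> 'a letter list" where
  "lcons x w = (if w \<noteq> [] \<and> hd w = inv_letter x then tl w else x # w)"

definition free_group :: "'a set \<Rightarrow> 'a letter list monoid" where
  "free_group A =
     \<lparr>carrier = {w. reduced w \<and> set w \<subseteq> A \<times> UNIV}, monoid.mult = (\<lambda>u v. foldr lcons u v), one = []\<rparr>"

section \<open>The boundary and the action on it\<close>

definition boundary :: "'a set \<Rightarrow> (nat \<Rightarrow> 'a letter) set" where
  "boundary A = {X. (\<forall>n. X n \<in> A \<times> UNIV) \<and> (\<forall>n. X (Suc n) \<noteq> inv_letter (X n))}"

definition prefix_word :: "nat \<Rightarrow> (nat \<Rightarrow> 'a letter) \<Rightarrow> 'a letter list" where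
  "prefix_word n X = map X [0..<n]"

definition bd_dist :: "(nat \<Rightarrow> 'a letter) \<Rightarrow> (nat \<Rightarrow> 'a letter) \<Rightarrow> real" where
  "bd_dist X Y =
     (if X = Y then 0 else exp (- real (Max {n. prefix_word n X = prefix_word n Y})))"

definition lcons_inf :: "'a letter \<Rightarrow> (nat \<Rightarrow> 'a letter) \<Rightarrow> nat \<Rightarrow> 'a letter" where
  "lcons_inf x X = (if X 0 = inv_letter x then (\<lambda>n. X (Suc n)) else case_nat x X)"

definition act :: "'a letter list \<Rightarrow> (nat \<Rightarrow> 'a letter) \<Rightarrow> nat \<Rightarrow> 'a letter" where
  "act w X = foldr lcons_inf w X"

definition boundary2 :: "'a set \<Rightarrow> ((nat \<Rightarrow> 'a letter) \<times> (nat \<Rightarrow> 'a letter)) set" where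
  "boundary2 A = {(X, Y). X \<in> boundary A \<and> Y \<in> boundary A \<and> X \<noteq> Y}"

definition bd2_dist ::
  "(nat \<Rightarrow> 'a letter) \<times> (nat \<Rightarrow> 'a letter) \<Rightarrow> (nat \<Rightarrow> 'a letter) \<times> (nat \<Rightarrow> 'a letter) \<Rightarrow> real" where
  "bd2_dist p q = max (bd_dist (fst p) (fst q)) (bd_dist (snd p) (snd q))"

section \<open>Algebraic laminations\<close>

definition algebraic_laminations ::
  "'a set \<Rightarrow> ((nat \<Rightarrow> 'a letter) \<times> (nat \<Rightarrow> 'a letter)) set set" where
  "algebraic_laminations A =
     {L. L \<subseteq> boundary2 A \<and> L \<noteq> {} \<and>
         closedin (Metric_space.mtopology (boundary2 A) bd2_dist) L \<and>
         (\<forall>(X, Y) \<in> L. (Y, X) \<in> L) \<and>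
         (\<forall>w \<in> carrier (free_group A). \<forall>(X, Y) \<in> L. (act w X, act w Y) \<in> L)}"

text \<open>For empty arguments the suprema and infima below would be unspecified reals. The value 0 there
  keeps the distance non-negative everywhere, as the locale \<open>Metric_space\<close> demands; laminations
  are non-empty, so they are not affected.\<close>

definition hausdorff_dist :: "('b \<Rightarrow> 'b \<Rightarrow> real) \<Rightarrow> 'b set \<Rightarrow> 'b set \<Rightarrow> real" where
  "hausdorff_dist d S T =
     (if S = {} \<or> T = {} then 0
      else max (SUP x\<in>S. INF y\<in>T. d x y) (SUP y\<in>T. INF x\<in>S. d x y))"

definition lamination_topology ::
  "'a set \<Rightarrow> ((nat \<Rightarrow> 'a letter) \<times> (nat \<Rightarrow> 'a letter)) set topology" where
  "lamination_topology A =
     Metric_space.mtopology (algebraic_laminations A) (hausdorff_dist bd2_dist)"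

definition minimal_lamination ::
  "'a set \<Rightarrow> ((nat \<Rightarrow> 'a letter) \<times> (nat \<Rightarrow> 'a letter)) set \<Rightarrow> bool" where
  "minimal_lamination A L \<longleftrightarrow>
     L \<in> algebraic_laminations A \<and> (\<forall>L' \<in> algebraic_laminations A. \<not> L' \<subset> L)"

section \<open>Rational laminations\<close>

text \<open>Convergence of group elements to a boundary point, in the Gromov compactification: a prefix
  of any given length is eventually constant and agrees with that of the limit.\<close>

definition converges_to_bd :: "(nat \<Rightarrow> 'a letter list) \<Rightarrow> (nat \<Rightarrow> 'a letter) \<Rightarrow> bool" where
  "converges_to_bd u X \<longleftrightarrow> (\<forall>k. \<forall>\<^sub>F n in sequentially. take k (u n) = prefix_word k X)"

definition bd_limit :: "'a set \<Rightarrow> (nat \<Rightarrow> 'a letter list) \<Rightarrow> nat \<Rightarrow> 'a letter" where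
  "bd_limit A u = (THE X. X \<in> boundary A \<and> converges_to_bd u X)"

definition pos_end :: "'a set \<Rightarrow> 'a letter list \<Rightarrow> nat \<Rightarrow> 'a letter" where
  "pos_end A w = bd_limit A (\<lambda>n. w [^]\<^bsub>free_group A\<^esub> int n)"

definition neg_end :: "'a set \<Rightarrow> 'a letter list \<Rightarrow> nat \<Rightarrow> 'a letter" where
  "neg_end A w = bd_limit A (\<lambda>n. w [^]\<^bsub>free_group A\<^esub> (- int n))"

definition lam_of ::
  "'a set \<Rightarrow> 'a letter list \<Rightarrow> ((nat \<Rightarrow> 'a letter) \<times> (nat \<Rightarrow> 'a letter)) set" where
  "lam_of A w =
     {(act v (neg_end A w), act v (pos_end A w)) | v. v \<in> carrier (free_group A)} \<union>
     {(act v (pos_end A w), act v (neg_end A w)) | v. v \<in> carrier (free_group A)}"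

definition rational_laminations ::
  "'a set \<Rightarrow> ((nat \<Rightarrow> 'a letter) \<times> (nat \<Rightarrow> 'a letter)) set set" where
  "rational_laminations A =
     {\<Union>w\<in>W. lam_of A w | W.
        finite W \<and> W \<noteq> {} \<and> W \<subseteq> carrier (free_group A) - {\<one>\<^bsub>free_group A\<^esub>}}"

section \<open>Basic facts\<close>

lemma inv_letter_inv_letter [simp]: "inv_letter (inv_letter x) = x"
  by (simp add: inv_letter_def)

lemma inv_letter_neq [simp]: "inv_letter x \<noteq> x" "x \<noteq> inv_letter x"
  by (cases x; simp add: inv_letter_def)+

lemma inv_letter_in_iff [simp]: "inv_letter x \<in> A \<times> UNIV \<longleftrightarrow> x \<in> A \<times> UNIV"
  by (cases x) (simp add: inv_letter_def)

lemma reduced_Nil [simp]: "reduced []"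
  by (simp add: reduced_def)

lemma reduced_Cons: "reduced (x # w) \<longleftrightarrow> reduced w \<and> (w \<noteq> [] \<longrightarrow> hd w \<noteq> inv_letter x)"
  by (cases w) (auto simp: reduced_def)

lemma lcons_reduced: "reduced w \<Longrightarrow> reduced (lcons x w)"
  by (cases w) (auto simp: lcons_def reduced_Cons)

lemma lcons_set: "x \<in> B \<Longrightarrow> set w \<subseteq> B \<Longrightarrow> set (lcons x w) \<subseteq> B"
  by (cases w) (auto simp: lcons_def)

lemma lcons_lcons_inv [simp]: "reduced w \<Longrightarrow> lcons x (lcons (inv_letter x) w) = w"
  by (cases w; cases "tl w") (auto simp: lcons_def reduced_Cons)

lemma lcons_inv_lcons [simp]: "reduced w \<Longrightarrow> lcons (inv_letter x) (lcons x w) = w"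
  using lcons_lcons_inv[of w "inv_letter x"] by simp

lemma foldr_lcons_reduced: "reduced w \<Longrightarrow> reduced (foldr lcons u w)"
  by (induction u) (auto simp: lcons_reduced)

lemma foldr_lcons_set: "set u \<subseteq> B \<Longrightarrow> set w \<subseteq> B \<Longrightarrow> set (foldr lcons u w) \<subseteq> B"
proof (induction u)
  case (Cons x u)
  then show ?case using lcons_set[of x B "foldr lcons u w"] by simp
qed simp

lemma foldr_lcons_lcons:
  assumes "reduced w"
  shows "foldr lcons (lcons x v) w = lcons x (foldr lcons v w)"
proof (cases "v \<noteq> [] \<and> hd v = inv_letter x")
  case True
  then obtain v' where "v = inv_letter x # v'" by (cases v) auto
  then show ?thesis using assms by (simp add: lcons_def[of x "inv_letter x # v'"] foldr_lcons_reduced)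
qed (auto simp: lcons_def[of x v])

lemma foldr_lcons_assoc:
  "reduced w \<Longrightarrow> foldr lcons (foldr lcons u v) w = foldr lcons u (foldr lcons v w)"
  by (induction u) (simp_all add: foldr_lcons_lcons)

lemma foldr_lcons_Nil: "reduced w \<Longrightarrow> foldr lcons w [] = w"
  by (induction w) (auto simp: reduced_Cons lcons_def)

lemma foldr_lcons_inverse: "foldr lcons (rev (map inv_letter w)) w = []"
  by (induction w) (simp_all add: lcons_def)

lemma free_group_group: "group (free_group A)"
proof (rule groupI)
  fix u assume "u \<in> carrier (free_group A)"
  then have u: "reduced u" "set u \<subseteq> A \<times> UNIV" by (auto simp: free_group_def)
  let ?v = "foldr lcons (rev (map inv_letter u)) []"
  have "set (rev (map inv_letter u)) \<subseteq> A \<times> UNIV" using u(2) by (auto simp: inv_letter_def)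
  then have "?v \<in> carrier (free_group A)"
    using foldr_lcons_set[of "rev (map inv_letter u)" "A \<times> UNIV" "[]"]
    by (simp add: free_group_def foldr_lcons_reduced)
  moreover have "?v \<otimes>\<^bsub>free_group A\<^esub> u = \<one>\<^bsub>free_group A\<^esub>"
    using u(1) by (simp add: free_group_def foldr_lcons_assoc foldr_lcons_inverse)
  ultimately show "\<exists>v\<in>carrier (free_group A). v \<otimes>\<^bsub>free_group A\<^esub> u = \<one>\<^bsub>free_group A\<^esub>" by blast
qed (auto simp: free_group_def foldr_lcons_reduced foldr_lcons_assoc
       dest: subsetD[OF foldr_lcons_set, rotated 2])

text \<open>The universal property: \<open>free_group A\<close> is free on the words of length one in \<open>A\<close>.\<close>

lemma free_group_universal:
  fixes H :: "('h, 'm) monoid_scheme"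
  assumes "group H" and f: "\<And>a. a \<in> A \<Longrightarrow> f a \<in> carrier H"
  shows "\<exists>h. h \<in> hom (free_group A) H \<and> (\<forall>a\<in>A. h [(a, True)] = f a) \<and>
    (\<forall>h'. h' \<in> hom (free_group A) H \<and> (\<forall>a\<in>A. h' [(a, True)] = f a) \<longrightarrow>
       (\<forall>w \<in> carrier (free_group A). h' w = h w))"
proof -
  interpret H: group H by fact
  interpret F: group "free_group A" by (rule free_group_group)
  define g where "g x = (if snd x then f (fst x) else inv\<^bsub>H\<^esub> f (fst x))" for x :: "'a letter"
  define h where "h w = foldr (\<lambda>x y. g x \<otimes>\<^bsub>H\<^esub> y) w \<one>\<^bsub>H\<^esub>" for w
  have g: "g x \<in> carrier H" if "x \<in> A \<times> UNIV" for x using that f by (auto simp: g_def)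
  have g_inv: "g (inv_letter x) = inv\<^bsub>H\<^esub> g x" if "x \<in> A \<times> UNIV" for x
    using that f by (auto simp: g_def inv_letter_def)
  have h: "h w \<in> carrier H" if "set w \<subseteq> A \<times> UNIV" for w
    using that by (induction w) (auto simp: h_def g)
  have h_lcons: "h (lcons x w) = g x \<otimes>\<^bsub>H\<^esub> h w" if "x \<in> A \<times> UNIV" "set w \<subseteq> A \<times> UNIV" for x w
  proof (cases "w \<noteq> [] \<and> hd w = inv_letter x")
    case True
    then obtain w' where w: "w = inv_letter x # w'" by (cases w) auto
    have "h w = inv\<^bsub>H\<^esub> g x \<otimes>\<^bsub>H\<^esub> h w'" using that w by (simp add: h_def g_inv)
    moreover have "lcons x w = w'" using w by (simp add: lcons_def)
    moreover have "h w' \<in> carrier H" using that w h by simp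
    ultimately show ?thesis using g[OF that(1)] by (simp add: H.m_assoc[symmetric])
  qed (auto simp: lcons_def h_def)
  have h_mult: "h (foldr lcons u v) = h u \<otimes>\<^bsub>H\<^esub> h v"
    if "set u \<subseteq> A \<times> UNIV" "set v \<subseteq> A \<times> UNIV" for u v
    using that(1)
  proof (induction u)
    case Nil
    then show ?case using h[OF that(2)] by (simp add: h_def[of "[]"])
  next
    case (Cons x u)
    have "h (x # u) = g x \<otimes>\<^bsub>H\<^esub> h u" by (simp add: h_def)
    then show ?case using Cons that(2) foldr_lcons_set[of u "A \<times> UNIV" v]
      by (auto simp: h_lcons H.m_assoc g h)
  qed
  have "h \<in> hom (free_group A) H"
    by (rule homI) (auto simp: free_group_def h h_mult)
  moreover have "\<forall>a\<in>A. h [(a, True)] = f a" using f by (simp add: h_def g_def)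
  moreover have "h' w = h w"
    if h'_hom: "h' \<in> hom (free_group A) H" and h'_f: "\<forall>a\<in>A. h' [(a, True)] = f a"
      and w: "w \<in> carrier (free_group A)"
    for h' w
  proof -
    interpret h': group_hom "free_group A" H h'
      using h'_hom \<open>group H\<close> by (simp add: group_hom_def group_hom_axioms_def free_group_group)
    have letter: "h' [x] = g x" if x: "x \<in> A \<times> UNIV" for x
    proof (cases "snd x")
      case True
      then show ?thesis using x h'_f by (cases x) (auto simp: g_def)
    next
      case False
      then obtain a where a: "x = (a, False)" "a \<in> A" using x by (cases x) auto
      have c: "[(a, True)] \<in> carrier (free_group A)" "[x] \<in> carrier (free_group A)"
        using a by (auto simp: free_group_def reduced_def)
      have "[x] \<otimes>\<^bsub>free_group A\<^esub> [(a, True)] = \<one>\<^bsub>free_group A\<^esub>"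
        using a by (simp add: free_group_def lcons_def inv_letter_def)
      then have "[x] = inv\<^bsub>free_group A\<^esub> [(a, True)]" using c F.inv_equality by metis
      then have "h' [x] = inv\<^bsub>H\<^esub> h' [(a, True)]" using c by simp
      then show ?thesis using a h'_f by (simp add: g_def)
    qed
    have "reduced w" "set w \<subseteq> A \<times> UNIV" using w by (auto simp: free_group_def)
    then show ?thesis
    proof (induction w)
      case Nil
      then show ?case using h'.hom_one by (simp add: free_group_def h_def)
    next
      case (Cons x w)
      then have c: "[x] \<in> carrier (free_group A)" "w \<in> carrier (free_group A)"
        by (auto simp: free_group_def reduced_Cons)
      have "x # w = [x] \<otimes>\<^bsub>free_group A\<^esub> w"
        using Cons.prems by (auto simp: free_group_def lcons_def reduced_Cons)
      then have "h' (x # w) = h' [x] \<otimes>\<^bsub>H\<^esub> h' w" using c by simp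
      also have "\<dots> = g x \<otimes>\<^bsub>H\<^esub> h w" using Cons letter by (simp add: reduced_Cons)
      finally show ?case by (simp add: h_def)
    qed
  qed
  ultimately show ?thesis by blast
qed

lemma lcons_inf_boundary:
  assumes "x \<in> A \<times> UNIV" "X \<in> boundary A"
  shows "lcons_inf x X \<in> boundary A"
  using assms by (auto simp: lcons_inf_def boundary_def split: nat.splits)

lemma lcons_inf_inv:
  assumes "X \<in> boundary A"
  shows "lcons_inf x (lcons_inf (inv_letter x) X) = X"
  using assms by (auto simp: lcons_inf_def boundary_def fun_eq_iff split: nat.splits)

lemma act_boundary: "w \<in> carrier (free_group A) \<Longrightarrow> X \<in> boundary A \<Longrightarrow> act w X \<in> boundary A"
proof -
  assume "w \<in> carrier (free_group A)" and X: "X \<in> boundary A"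
  then have "set w \<subseteq> A \<times> UNIV" by (simp add: free_group_def)
  then show ?thesis using X by (induction w) (auto simp: act_def intro!: lcons_inf_boundary)
qed

lemma act_one: "act \<one>\<^bsub>free_group A\<^esub> X = X"
  by (simp add: act_def free_group_def)

lemma act_mult:
  assumes "u \<in> carrier (free_group A)" "v \<in> carrier (free_group A)" "X \<in> boundary A"
  shows "act (u \<otimes>\<^bsub>free_group A\<^esub> v) X = act u (act v X)"
proof -
  have bd: "foldr lcons_inf w X \<in> boundary A" if "set w \<subseteq> A \<times> UNIV" for w
    using that assms(3) by (induction w) (auto intro!: lcons_inf_boundary)
  have step: "foldr lcons_inf (lcons x w) X = lcons_inf x (foldr lcons_inf w X)"
    if "set w \<subseteq> A \<times> UNIV" for x w
  proof (cases "w \<noteq> [] \<and> hd w = inv_letter x")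
    case True
    then obtain w' where w: "w = inv_letter x # w'" by (cases w) auto
    then have "foldr lcons_inf w' X \<in> boundary A" using that bd by simp
    then show ?thesis using w by (simp add: lcons_def lcons_inf_inv)
  qed (auto simp: lcons_def)
  have "set u \<subseteq> A \<times> UNIV" "set v \<subseteq> A \<times> UNIV" using assms by (auto simp: free_group_def)
  then have "foldr lcons_inf (foldr lcons u v) X = foldr lcons_inf u (foldr lcons_inf v X)"
    by (induction u) (auto simp: step foldr_lcons_set)
  then show ?thesis by (simp add: act_def free_group_def)
qed

lemma prefix_word_eq_iff: "prefix_word n X = prefix_word n Y \<longleftrightarrow> (\<forall>i<n. X i = Y i)"
  by (auto simp: prefix_word_def)

lemma finite_common_prefixes:
  assumes "X \<noteq> Y"
  shows "finite {n. prefix_word n X = prefix_word n Y}"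
proof -
  obtain i where "X i \<noteq> Y i" using assms by auto
  then have "{n. prefix_word n X = prefix_word n Y} \<subseteq> {..i}"
    by (auto simp: prefix_word_eq_iff not_less[symmetric])
  then show ?thesis by (rule finite_subset) simp
qed

lemma bd_dist_le_iff: "bd_dist X Y \<le> exp (- real k) \<longleftrightarrow> prefix_word k X = prefix_word k Y"
proof (cases "X = Y")
  case False
  let ?P = "{n. prefix_word n X = prefix_word n Y}"
  have fin: "finite ?P" using finite_common_prefixes[OF False] .
  have "0 \<in> ?P" by (simp add: prefix_word_def)
  then have ne: "?P \<noteq> {}" by blast
  have "bd_dist X Y \<le> exp (- real k) \<longleftrightarrow> k \<le> Max ?P" using False by (simp add: bd_dist_def)
  also have "\<dots> \<longleftrightarrow> k \<in> ?P"
  proof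
    assume "k \<le> Max ?P"
    moreover have "Max ?P \<in> ?P" using Max_in[OF fin ne] .
    ultimately show "k \<in> ?P" by (auto simp: prefix_word_eq_iff)
  qed (use fin in auto)
  finally show ?thesis by simp
qed (simp add: bd_dist_def)

lemma bd_dist_nonneg [simp]: "0 \<le> bd_dist X Y"
  by (simp add: bd_dist_def)

lemma bd_dist_le_1: "bd_dist X Y \<le> 1"
  using bd_dist_le_iff[of X Y 0] by (simp add: prefix_word_def)

lemma bd_dist_commute: "bd_dist X Y = bd_dist Y X"
  by (simp add: bd_dist_def eq_commute)

lemma bd_dist_zero [simp]: "bd_dist X Y = 0 \<longleftrightarrow> X = Y"
  by (simp add: bd_dist_def)

lemma bd_dist_ultra: "bd_dist X Z \<le> max (bd_dist X Y) (bd_dist Y Z)"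
proof (cases "X = Y \<or> Y = Z")
  case False
  define k where "k = min (Max {n. prefix_word n X = prefix_word n Y})
                          (Max {n. prefix_word n Y = prefix_word n Z})"
  have m: "max (bd_dist X Y) (bd_dist Y Z) = exp (- real k)"
    using False by (auto simp: bd_dist_def k_def max_def min_def)
  then have "bd_dist X Y \<le> exp (- real k)" "bd_dist Y Z \<le> exp (- real k)" by linarith+
  then have "bd_dist X Z \<le> exp (- real k)" by (simp add: bd_dist_le_iff)
  then show ?thesis using m by simp
qed auto

lemma Metric_space_boundary: "Metric_space (boundary A) bd_dist"
proof
  fix X Y Z :: "nat \<Rightarrow> 'a letter"
  show "bd_dist X Z \<le> bd_dist X Y + bd_dist Y Z"
    using bd_dist_ultra[of X Z Y] bd_dist_nonneg[of X Y] bd_dist_nonneg[of Y Z] by linarith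
qed (auto simp: bd_dist_commute)

lemma bd2_dist_nonneg [simp]: "0 \<le> bd2_dist p q"
  by (simp add: bd2_dist_def le_max_iff_disj)

lemma bd2_dist_le_1: "bd2_dist p q \<le> 1"
  by (simp add: bd2_dist_def bd_dist_le_1)

lemma bd2_dist_triangle: "bd2_dist p r \<le> bd2_dist p q + bd2_dist q r"
proof -
  have "bd_dist X Z \<le> bd_dist X Y + bd_dist Y Z" for X Y Z :: "nat \<Rightarrow> 'a letter"
    using bd_dist_ultra[of X Z Y] bd_dist_nonneg[of X Y] bd_dist_nonneg[of Y Z] by linarith
  from this[of "fst p" "fst r" "fst q"] this[of "snd p" "snd r" "snd q"]
  show ?thesis unfolding bd2_dist_def by linarith
qed

lemma bd2_dist_commute: "bd2_dist p q = bd2_dist q p"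
  by (simp add: bd2_dist_def bd_dist_commute)

lemma bd2_dist_zero [simp]: "bd2_dist p q = 0 \<longleftrightarrow> p = q"
proof -
  have "bd2_dist p q = 0 \<longleftrightarrow> bd_dist (fst p) (fst q) = 0 \<and> bd_dist (snd p) (snd q) = 0"
    using bd_dist_nonneg[of "fst p" "fst q"] bd_dist_nonneg[of "snd p" "snd q"]
    unfolding bd2_dist_def by linarith
  then show ?thesis by (simp add: prod_eq_iff)
qed

lemma Metric_space_boundary2: "Metric_space (boundary2 A) bd2_dist"
  by unfold_locales (auto simp: bd2_dist_commute bd2_dist_triangle)

text \<open>The Hausdorff distance is a metric on the non-empty closed sets of a bounded metric space.\<close>

lemma Metric_space_hausdorff:
  fixes d :: "'b \<Rightarrow> 'b \<Rightarrow> real"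
  assumes "Metric_space M d" and le1: "\<And>x y. d x y \<le> 1"
    and C: "\<And>S. S \<in> C \<Longrightarrow> S \<noteq> {} \<and> closedin (Metric_space.mtopology M d) S"
  shows "Metric_space C (hausdorff_dist d)"
proof -
  interpret Metric_space M d by fact
  define e where "e S T = (SUP x\<in>S. INF y\<in>T. d x y)" for S T
  have hd: "hausdorff_dist d S T = max (e S T) (e T S)" if "S \<noteq> {}" "T \<noteq> {}" for S T
    using that by (simp add: hausdorff_dist_def e_def commute)
  have bb: "bdd_below (d x ` T)" for x T by (rule bdd_belowI[of _ 0]) auto
  have inf0: "0 \<le> (INF y\<in>T. d x y)" if "T \<noteq> {}" for x T using that by (auto intro!: cINF_greatest)
  have inf1: "(INF y\<in>T. d x y) \<le> 1" if ne: "T \<noteq> {}" for x T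
  proof -
    obtain y where "y \<in> T" using ne by auto
    then show ?thesis using cINF_lower[OF bb, of y T x] le1[of x y] by linarith
  qed
  have ba: "bdd_above ((\<lambda>x. INF y\<in>T. d x y) ` S)" if "T \<noteq> {}" for S T
    by (rule bdd_aboveI[of _ 1]) (use inf1[OF that] in auto)
  have lower: "(INF y\<in>T. d x y) \<le> e S T" if "T \<noteq> {}" "x \<in> S" for x S T
    unfolding e_def using cSUP_upper[OF that(2) ba[OF that(1)]] .
  have e0: "0 \<le> e S T" if ne: "S \<noteq> {}" "T \<noteq> {}" for S T
  proof -
    obtain x where "x \<in> S" using ne by auto
    then show ?thesis using lower[OF ne(2), of x S] inf0[OF ne(2), of x] by linarith
  qed
  have near: "\<exists>y\<in>T. d x y < e S T + \<epsilon>" if "T \<noteq> {}" "x \<in> S" "\<epsilon> > 0" for x S T and \<epsilon> :: real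
  proof -
    have "(INF y\<in>T. d x y) < e S T + \<epsilon>" using lower[OF that(1,2)] that(3) by linarith
    then show ?thesis using cINF_less_iff[OF that(1) bb] by blast
  qed
  have sub: "S \<subseteq> T" if STC: "S \<in> C" "T \<in> C" "e S T = 0" for S T
  proof
    fix x assume x: "x \<in> S"
    have cl: "closedin mtopology T" "closedin mtopology S" using C STC by auto
    then have "x \<in> M" using x closedin_metric by auto
    show "x \<in> T"
    proof (rule ccontr)
      assume "x \<notin> T"
      then obtain r where r: "r > 0" "disjnt T (mball x r)"
        using cl(1) \<open>x \<in> M\<close> unfolding closedin_metric by blast
      obtain y where y: "y \<in> T" "d x y < r" using near[of T x S r] STC C r(1) x by auto
      then have "y \<in> M" using cl(1) closedin_metric by auto
      then have "y \<in> mball x r" using y \<open>x \<in> M\<close> by simp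
      then show False using y r(2) by (auto simp: disjnt_def)
    qed
  qed
  have CM: "S \<subseteq> M" if "S \<in> C" for S using C[OF that] closedin_metric by auto
  have e_tri: "e S U \<le> e S T + e T U" if "S \<in> C" "T \<in> C" "U \<in> C" for S T U
  proof -
    have ne: "S \<noteq> {}" "T \<noteq> {}" "U \<noteq> {}" using C that by auto
    have "(INF z\<in>U. d x z) \<le> e S T + e T U" if x: "x \<in> S" for x
    proof (rule field_le_epsilon)
      fix \<epsilon> :: real assume eps: "\<epsilon> > 0"
      obtain y where y: "y \<in> T" "d x y < e S T + \<epsilon>/2" using near[of T x S "\<epsilon>/2"] ne x eps by auto
      obtain z where z: "z \<in> U" "d y z < e T U + \<epsilon>/2" using near[of U y T "\<epsilon>/2"] ne y eps by auto
      have "(INF z\<in>U. d x z) \<le> d x z" using cINF_lower[OF bb z(1)] .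
      also have "\<dots> \<le> d x y + d y z"
        using triangle[of x y z] x y z CM[OF \<open>S \<in> C\<close>] CM[OF \<open>T \<in> C\<close>] CM[OF \<open>U \<in> C\<close>] by blast
      finally show "(INF z\<in>U. d x z) \<le> e S T + e T U + \<epsilon>" using y z by simp
    qed
    then show ?thesis unfolding e_def[of S U] using ne(1) by (intro cSUP_least) auto
  qed
  show ?thesis
  proof
    fix S T
    show "0 \<le> hausdorff_dist d S T"
    proof (cases "S = {} \<or> T = {}")
      case False
      then show ?thesis using hd[of S T] e0[of S T] by (simp add: le_max_iff_disj)
    qed (auto simp: hausdorff_dist_def)
    show "hausdorff_dist d S T = hausdorff_dist d T S"
    proof (cases "S = {} \<or> T = {}")
      case False
      then show ?thesis using hd[of S T] hd[of T S] by (simp add: max.commute)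
    qed (auto simp: hausdorff_dist_def)
  next
    fix S T assume ST: "S \<in> C" "T \<in> C"
    then have ne: "S \<noteq> {}" "T \<noteq> {}" using C by auto
    show "hausdorff_dist d S T = 0 \<longleftrightarrow> S = T"
    proof
      assume "hausdorff_dist d S T = 0"
      then have "e S T = 0" "e T S = 0" using hd[OF ne] e0[OF ne] e0[OF ne(2,1)] by linarith+
      then show "S = T" using sub ST by blast
    next
      assume "S = T"
      have "(INF y\<in>S. d x y) = 0" if "x \<in> S" for x
      proof -
        have "x \<in> M" using that CM ST by auto
        then have "(INF y\<in>S. d x y) \<le> 0" using cINF_lower[OF bb that, of x] by simp
        then show ?thesis using inf0[OF ne(1), of x] by linarith
      qed
      then have "e S S = 0" unfolding e_def using ne(1) by simp
      then show "hausdorff_dist d S T = 0" using hd[OF ne] \<open>S = T\<close> by simp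
    qed
  next
    fix S T U assume STU: "S \<in> C" "T \<in> C" "U \<in> C"
    then have ne: "S \<noteq> {}" "T \<noteq> {}" "U \<noteq> {}" using C by auto
    show "hausdorff_dist d S U \<le> hausdorff_dist d S T + hausdorff_dist d T U"
      unfolding hd[OF ne(1,3)] hd[OF ne(1,2)] hd[OF ne(2,3)]
      using e_tri[OF STU] e_tri[OF STU(3,2,1)] by linarith
  qed
qed

lemma Metric_space_laminations:
  "Metric_space (algebraic_laminations A) (hausdorff_dist bd2_dist)"
  by (rule Metric_space_hausdorff[OF Metric_space_boundary2[of A]])
     (auto simp: bd2_dist_le_1 algebraic_laminations_def)

lemma topspace_lamination_topology [simp]:
  "topspace (lamination_topology A) = algebraic_laminations A"
  unfolding lamination_topology_def
  by (rule Metric_space.topspace_mtopology[OF Metric_space_laminations])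

end

theory Submission
  imports Defs
begin

text \<open>Up to the action of the free group, a point of the double boundary is a bi-infinite reduced
  word, so that algebraic laminations correspond to subshifts closed under formal inversion, and two
  laminations are at Hausdorff distance at most \<open>exp (-k)\<close> once their subshifts have the same windows
  of length \<open>2k\<close>. Rational laminations correspond to finite unions of periodic subshifts. The subshift
  of \<open>\<dots>aaabbb\<dots>\<close> cannot be approximated by periodic words, as these would have to return from \<open>b\<close> to
  \<open>a\<close>. In a minimal subshift every window recurs, up to inversion, in every half-infinite word, so one
  can cut a long piece, beginning and ending with the same window, out of any word; its periodic
  repetition has exactly the windows of the subshift.\<close>

section \<open>Bi-infinite reduced words\<close>

text \<open>Distances between pairs are measured from the vertex \<open>1\<close>. Every pair is a
  common prefix \<open>p\<close> followed by a leaf through \<open>1\<close>, and a common prefix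
  only brings two such pairs closer together. Hence windows around the base point control the
  Hausdorff distance uniformly over the whole group orbit, although the double boundary is not
  compact.

  For minimal laminations the obstacle is orientation. Minimality among flip-invariant sets gives
  recurrence of a window only up to inversion, whereas closing up a piece of a word needs the same
  window twice with the same orientation. The oriented return therefore comes from the pigeonhole
  principle on finitely many windows. Minimality only has to make every window occur inside the
  piece, up to inversion; this is enough, since the periodic subshift contains reversals.

  For the failure of density, windows of two letters suffice: they record the transitions between
  neighbouring letters. This yields the explicit radius \<open>exp (-1)\<close>. Unions of many
  \<open>lam_of A w\<close> are no better than a single one, since the contradiction arises in the
  member containing one chosen leaf.\<close>

definition biinf :: "'a set \<Rightarrow> (int \<Rightarrow> 'a letter) set" where
  "biinf A = {Z. \<forall>i. Z i \<in> A \<times> UNIV \<and> Z (i + 1) \<noteq> inv_letter (Z i)}"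

text \<open>A bi-infinite word based at the gap between the positions \<open>-1\<close> and \<open>0\<close> is the geodesic in the
  Cayley tree through \<open>1\<close> joining the two ends \<open>leaf Z\<close>: one reads it backwards, with inverted letters,
  and forwards from the base point.\<close>

definition leaf :: "(int \<Rightarrow> 'a letter) \<Rightarrow> (nat \<Rightarrow> 'a letter) \<times> (nat \<Rightarrow> 'a letter)" where
  "leaf Z = (\<lambda>n. inv_letter (Z (- 1 - int n)), \<lambda>n. Z (int n))"

definition shift :: "int \<Rightarrow> (int \<Rightarrow> 'b) \<Rightarrow> int \<Rightarrow> 'b" where
  "shift m Z = (\<lambda>i. Z (i + m))"

text \<open>The reflection is centred at the gap between \<open>-1\<close> and \<open>0\<close>, so
  that it fixes the base point and exchanges the two rays of \<open>leaf\<close>. Reversal thus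
  becomes the flip.\<close>

definition reverse :: "(int \<Rightarrow> 'a letter) \<Rightarrow> int \<Rightarrow> 'a letter" where
  "reverse Z = (\<lambda>i. inv_letter (Z (- 1 - i)))"

text \<open>The window is symmetric about the base point: it consists of the first \<open>k\<close>
  letters of either ray of \<open>leaf\<close>.\<close>

definition agree :: "nat \<Rightarrow> (int \<Rightarrow> 'b) \<Rightarrow> (int \<Rightarrow> 'b) \<Rightarrow> bool" where
  "agree k Z Z' \<longleftrightarrow> (\<forall>i. - int k \<le> i \<and> i < int k \<longrightarrow> Z i = Z' i)"

definition act2 :: "'a letter list \<Rightarrow> (nat \<Rightarrow> 'a letter) \<times> (nat \<Rightarrow> 'a letter) \<Rightarrow>
    (nat \<Rightarrow> 'a letter) \<times> (nat \<Rightarrow> 'a letter)" where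
  "act2 g = map_prod (act g) (act g)"

text \<open>Plain concatenation, without the cancellation that \<open>act\<close> performs. It
  serves to write pairs in a normal form.\<close>

definition prepend :: "'b list \<Rightarrow> (nat \<Rightarrow> 'b) \<Rightarrow> nat \<Rightarrow> 'b" where
  "prepend p X = foldr case_nat p X"

abbreviation prepend2 :: "'b list \<Rightarrow> (nat \<Rightarrow> 'b) \<times> (nat \<Rightarrow> 'b) \<Rightarrow> (nat \<Rightarrow> 'b) \<times> (nat \<Rightarrow> 'b)" where
  "prepend2 p \<equiv> map_prod (prepend p) (prepend p)"

definition orbit :: "'a set \<Rightarrow> (int \<Rightarrow> 'a letter) set \<Rightarrow>
    ((nat \<Rightarrow> 'a letter) \<times> (nat \<Rightarrow> 'a letter)) set" where
  "orbit A S = {act2 g (leaf Z) | g Z. g \<in> carrier (free_group A) \<and> Z \<in> S}"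

definition words_of :: "'a set \<Rightarrow> ((nat \<Rightarrow> 'a letter) \<times> (nat \<Rightarrow> 'a letter)) set \<Rightarrow>
    (int \<Rightarrow> 'a letter) set" where
  "words_of A L = {Z \<in> biinf A. leaf Z \<in> L}"

text \<open>The last clause is closedness in the product topology, expressed through
  windows.\<close>

definition subshift :: "'a set \<Rightarrow> (int \<Rightarrow> 'a letter) set \<Rightarrow> bool" where
  "subshift A S \<longleftrightarrow> S \<subseteq> biinf A \<and> S \<noteq> {} \<and> (\<forall>Z\<in>S. \<forall>m. shift m Z \<in> S) \<and> (\<forall>Z\<in>S. reverse Z \<in> S) \<and>
     (\<forall>Z\<in>biinf A. (\<forall>k. \<exists>Z'\<in>S. agree k Z Z') \<longrightarrow> Z \<in> S)"

lemma inv_letter_eq_iff [simp]: "inv_letter x = inv_letter y \<longleftrightarrow> x = y"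
  by (metis inv_letter_inv_letter)

lemma shift_shift [simp]: "shift m (shift n Z) = shift (m + n) Z"
  by (simp add: shift_def fun_eq_iff algebra_simps)

lemma shift_0 [simp]: "shift 0 Z = Z"
  by (simp add: shift_def)

lemma reverse_reverse [simp]: "reverse (reverse Z) = Z"
  by (simp add: reverse_def)

lemma reverse_shift: "reverse (shift m Z) = shift (- m) (reverse Z)"
  by (simp add: reverse_def shift_def fun_eq_iff algebra_simps)

lemma biinfD:
  assumes "Z \<in> biinf A"
  shows "Z i \<in> A \<times> UNIV" "j = i + 1 \<Longrightarrow> Z j \<noteq> inv_letter (Z i)"
  using assms by (simp_all add: biinf_def del: mem_Sigma_iff)

lemma biinfI:
  "(\<And>i. Z i \<in> A \<times> UNIV) \<Longrightarrow> (\<And>i. Z (i + 1) \<noteq> inv_letter (Z i)) \<Longrightarrow> Z \<in> biinf A"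
  by (simp add: biinf_def del: mem_Sigma_iff)

lemma shift_biinf: "Z \<in> biinf A \<Longrightarrow> shift m Z \<in> biinf A"
  by (rule biinfI; unfold shift_def; rule biinfD) auto

lemma reverse_biinf:
  assumes "Z \<in> biinf A" shows "reverse Z \<in> biinf A"
proof (rule biinfI)
  fix i
  show "reverse Z i \<in> A \<times> UNIV"
    unfolding reverse_def inv_letter_in_iff by (rule biinfD[OF assms])
  have "Z (- 1 - i) \<noteq> inv_letter (Z (- 1 - (i + 1)))"
    by (rule biinfD[OF assms]) simp
  then show "reverse Z (i + 1) \<noteq> inv_letter (reverse Z i)"
    by (auto simp: reverse_def)
qed

lemma leaf_reverse: "leaf (reverse Z) = prod.swap (leaf Z)"
  by (simp add: leaf_def reverse_def)

lemma leaf_inj: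
  assumes "leaf Z = leaf Z'" shows "Z = Z'"
proof
  fix i
  have "Z (- 1 - int n) = Z' (- 1 - int n)" "Z (int n) = Z' (int n)" for n
    using assms by (simp_all add: leaf_def fun_eq_iff)
  from this(1)[of "nat (- 1 - i)"] this(2)[of "nat i"] show "Z i = Z' i"
    by (cases "i \<ge> 0") auto
qed

lemma leaf_heads_neq: "Z \<in> biinf A \<Longrightarrow> fst (leaf Z) 0 \<noteq> snd (leaf Z) 0"
  using biinfD(2)[of Z A 0 "- 1"] by (auto simp: leaf_def)

lemma leaf_boundary2:
  assumes "Z \<in> biinf A" shows "leaf Z \<in> boundary2 A"
proof -
  have *: "snd (leaf V) \<in> boundary A" if "V \<in> biinf A" for V
    using biinfD(1)[OF that] biinfD(2)[OF that, of "1 + int n" "int n" for n]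
    by (simp add: leaf_def boundary_def del: mem_Sigma_iff)
  have "fst (leaf Z) \<in> boundary A"
    using *[OF reverse_biinf[OF assms]] by (simp add: leaf_reverse)
  then show ?thesis using *[OF assms] leaf_heads_neq[OF assms]
    by (auto simp: boundary2_def split: prod.splits)
qed

lemma agreeD: "agree k Z V \<Longrightarrow> - int k \<le> i \<Longrightarrow> i < int k \<Longrightarrow> Z i = V i"
  by (simp add: agree_def)

lemma agree_sym: "agree k Z Z' \<Longrightarrow> agree k Z' Z"
  by (simp add: agree_def)

lemma agree_trans: "agree k Z Z' \<Longrightarrow> agree k Z' Z'' \<Longrightarrow> agree k Z Z''"
  by (simp add: agree_def)

lemma agree_mono: "agree k Z Z' \<Longrightarrow> j \<le> k \<Longrightarrow> agree j Z Z'"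
  by (auto simp: agree_def)

lemma agree_shift: "agree (k + nat \<bar>m\<bar>) Z Z' \<Longrightarrow> agree k (shift m Z) (shift m Z')"
  unfolding agree_def shift_def
  by (intro allI impI, drule_tac x = "i + m" in spec) linarith

lemma agree_reverse: "agree k (reverse Z) (reverse Z') \<longleftrightarrow> agree k Z Z'"
proof -
  have *: "agree k (reverse V) (reverse V')" if "agree k V V'" for V V' :: "int \<Rightarrow> 'a letter"
    using that by (auto simp: agree_def reverse_def)
  from *[of Z Z'] *[of "reverse Z" "reverse Z'"] show ?thesis by auto
qed

lemma prepend_simps [simp]:
  "prepend [] X = X" "prepend (x # p) X = case_nat x (prepend p X)"
  by (simp_all add: prepend_def)

lemma prepend_nth: "prepend p X n = (if n < length p then p ! n else X (n - length p))"
  by (induction p arbitrary: n) (auto split: nat.splits)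

lemma act_Cons: "act (x # g) X = lcons_inf x (act g X)"
  by (simp add: act_def)

text \<open>The group moves the base point along the geodesic; if it leaves the geodesic, the two ends acquire
  a common prefix \<open>p\<close>.\<close>

lemma act_orbit_form:
  assumes "Z \<in> biinf A"
  shows "\<exists>p m. act2 g (leaf Z) = prepend2 p (leaf (shift m Z))"
proof (induction g)
  case Nil
  have "act2 [] (leaf Z) = prepend2 [] (leaf (shift 0 Z))"
    by (simp add: act2_def act_def prod_eq_iff)
  then show ?case by blast
next
  case (Cons x g)
  then obtain p m where
    IH: "act2 g (leaf Z) = prepend2 p (leaf (shift m Z))" by blast
  have step: "act2 (x # g) (leaf Z) =
      map_prod (lcons_inf x) (lcons_inf x) (prepend2 p (leaf (shift m Z)))"
    by (simp add: IH[symmetric] act2_def act_Cons prod_eq_iff)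
  show ?case
  proof (cases p)
    case (Cons y q)
    have "act2 (x # g) (leaf Z) = map_prod (prepend (if y = inv_letter x then q else x # p))
        (prepend (if y = inv_letter x then q else x # p)) (leaf (shift m Z))"
      unfolding step Cons by (simp add: prod_eq_iff lcons_inf_def)
    then show ?thesis by blast
  next
    case Nil
    define V where "V = shift m Z"
    have V: "act2 (x # g) (leaf Z) = map_prod (lcons_inf x) (lcons_inf x) (leaf V)"
      using step Nil by (simp add: V_def prod_eq_iff)
    have neq: "fst (leaf V) 0 \<noteq> snd (leaf V) 0"
      unfolding V_def using leaf_heads_neq[OF shift_biinf[OF assms]] .
    \<comment> \<open>The two rays start with different letters, so \<open>x\<close> cancels in at
      most one of them. Cancellation in the first ray moves the base point backwards along the word,
      in the second one forwards.\<close>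
    consider "fst (leaf V) 0 = inv_letter x" | "snd (leaf V) 0 = inv_letter x"
      | "fst (leaf V) 0 \<noteq> inv_letter x" "snd (leaf V) 0 \<noteq> inv_letter x" by blast
    then show ?thesis
    proof cases
      case 1
      then have "map_prod (lcons_inf x) (lcons_inf x) (leaf V) = leaf (shift (- 1) V)"
        using neq by (auto simp: lcons_inf_def leaf_def shift_def fun_eq_iff algebra_simps split: nat.splits)
      then have "act2 (x # g) (leaf Z) = prepend2 [] (leaf (shift (- 1 + m) Z))"
        using V by (simp add: V_def prod_eq_iff)
      then show ?thesis by blast
    next
      case 2
      then have "map_prod (lcons_inf x) (lcons_inf x) (leaf V) = leaf (shift 1 V)"
        using neq by (auto simp: lcons_inf_def leaf_def shift_def fun_eq_iff algebra_simps split: nat.splits)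
      then have "act2 (x # g) (leaf Z) = prepend2 [] (leaf (shift (1 + m) Z))"
        using V by (simp add: V_def prod_eq_iff)
      then show ?thesis by blast
    next
      case 3
      then have "act2 (x # g) (leaf Z) = prepend2 [x] (leaf (shift m Z))"
        unfolding V V_def[symmetric]
          by (simp only: lcons_inf_def prod_eq_iff fst_map_prod snd_map_prod prepend_simps if_False)
      then show ?thesis by blast
    qed
  qed
qed

text \<open>In the Cayley tree, \<open>p\<close> is the segment from \<open>1\<close> to the
  geodesic joining the two ends, and \<open>Z\<close> is that geodesic based at the branching
  point.\<close>

lemma boundary2_decomp:
  assumes "P \<in> boundary2 A"
  obtains p Z where "Z \<in> biinf A" "p \<in> carrier (free_group A)"
    "P = prepend2 p (leaf Z)"
proof -
  obtain X Y where P: "P = (X, Y)" "X \<in> boundary A" "Y \<in> boundary A" "X \<noteq> Y"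
    using assms by (auto simp: boundary2_def)
  define j where "j = (LEAST i. X i \<noteq> Y i)"
  have ex: "\<exists>i. X i \<noteq> Y i" using P(4) by auto
  have j: "X j \<noteq> Y j" unfolding j_def using LeastI_ex[OF ex] .
  have lt: "X i = Y i" if "i < j" for i using not_less_Least[of i "\<lambda>i. X i \<noteq> Y i"] that j_def by blast
  \<comment> \<open>The two tails after the branching point \<open>j\<close> are glued. The seam
    between \<open>-1\<close> and \<open>0\<close> is reduced precisely because \<open>X j\<close>
    and \<open>Y j\<close> differ.\<close>
  define Z where "Z i = (if 0 \<le> i then Y (j + nat i) else inv_letter (X (j + nat (- 1 - i))))" for i
  have X: "X n \<in> A \<times> UNIV" "X (Suc n) \<noteq> inv_letter (X n)"
    and Y: "Y n \<in> A \<times> UNIV" "Y (Suc n) \<noteq> inv_letter (Y n)" for n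
    using P by (auto simp: boundary_def)
  have "Z i \<in> A \<times> UNIV" for i unfolding Z_def using X Y by (simp del: mem_Sigma_iff)
  moreover have "Z (i + 1) \<noteq> inv_letter (Z i)" for i
  proof -
    consider "0 \<le> i" | "i = - 1" | "i < - 1" by linarith
    then show ?thesis
    proof cases
      case 1
      then have "nat (i + 1) = Suc (nat i)" by simp
      then show ?thesis using 1 Y(2)[of "j + nat i"] by (simp add: Z_def)
    next
      case 2
      then show ?thesis using j by (simp add: Z_def)
    next
      case 3
      then have e: "nat (- 1 - i) = Suc (nat (- 1 - (i + 1)))" by simp
      have "Z (i + 1) = inv_letter (X (j + nat (- 1 - (i + 1))))" using 3 by (simp add: Z_def)
      moreover have "Z i = inv_letter (X (Suc (j + nat (- 1 - (i + 1)))))"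
        using 3 unfolding Z_def e by simp
      ultimately show ?thesis using X(2)[of "j + nat (- 1 - (i + 1))"] by auto
    qed
  qed
  ultimately have Z: "Z \<in> biinf A" by (simp add: biinf_def)
  define p where "p = prefix_word j Y"
  have "reduced p" unfolding reduced_def successively_conv_nth p_def prefix_word_def using Y by auto
  moreover have "set p \<subseteq> A \<times> UNIV"
    unfolding p_def prefix_word_def using Y(1) by (simp add: image_subset_iff del: mem_Sigma_iff)
  ultimately have "p \<in> carrier (free_group A)" by (simp add: free_group_def)
  moreover have "P = prepend2 p (leaf Z)"
  proof -
    have "X n = prepend p (fst (leaf Z)) n" "Y n = prepend p (snd (leaf Z)) n" for n
      unfolding prepend_nth p_def prefix_word_def leaf_def Z_def using lt[of n] by auto
    then show ?thesis unfolding P(1) by (simp add: prod_eq_iff fun_eq_iff)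
  qed
  ultimately show thesis using that Z by blast
qed

section \<open>Laminations and subshifts\<close>

text \<open>Whether a letter cancels depends only on the next letter, so the absence of cancellation
  passes from \<open>Y\<close> to any \<open>X\<close> with the same head. With \<open>Y\<close>
  different from \<open>X\<close>, this carries a prefix over to a neighbouring leaf.\<close>

lemma prepend_eq_act:
  assumes "prepend p Y \<in> boundary A" "X 0 = Y 0"
  shows "act p X = prepend p X"
  using assms(1)
proof (induction p)
  case (Cons x p)
  then have "case_nat x (prepend p Y) \<in> boundary A" by simp
  then have *: "\<forall>n. case_nat x (prepend p Y) n \<in> A \<times> UNIV"
    "\<forall>n. case_nat x (prepend p Y) (Suc n) \<noteq> inv_letter (case_nat x (prepend p Y) n)"
    by (simp_all add: boundary_def del: mem_Sigma_iff)
  have "prepend p Y n \<in> A \<times> UNIV" "prepend p Y (Suc n) \<noteq> inv_letter (prepend p Y n)" for n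
    using *(1)[rule_format, of "Suc n"] *(2)[rule_format, of "Suc n"] by simp_all
  then have "prepend p Y \<in> boundary A" by (simp add: boundary_def del: mem_Sigma_iff)
  moreover have "prepend p X 0 \<noteq> inv_letter x"
    using *(2)[rule_format, of 0] assms(2) by (cases p) simp_all
  ultimately show ?case using Cons.IH by (simp add: act_Cons lcons_inf_def)
qed (simp add: act_def)

lemma prepend2_eq_act2:
  assumes "prepend2 p P \<in> boundary2 A" "fst Q 0 = fst P 0" "snd Q 0 = snd P 0"
  shows "act2 p Q = prepend2 p Q"
  using assms prepend_eq_act[of p "fst P" A "fst Q"] prepend_eq_act[of p "snd P" A "snd Q"]
  by (auto simp: act2_def boundary2_def prod_eq_iff)

text \<open>The rays of a leaf of a reduced word have different heads, so the place where the two
  ends first differ determines the length of the prefix.\<close>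

lemma prepend2_leaf_unique:
  assumes "Z \<in> biinf A" "V \<in> biinf A" "prepend2 p (leaf Z) = prepend2 q (leaf V)"
  shows "p = q \<and> Z = V"
  using assms(3)
proof (induction p arbitrary: q)
  case Nil
  then show ?case
  proof (cases q)
    case (Cons y q')
    then show ?thesis using Nil leaf_heads_neq[OF assms(1)] by (simp add: prod_eq_iff)
  qed (simp add: leaf_inj prod_eq_iff)
next
  case (Cons x p)
  show ?case
  proof (cases q)
    case Nil
    then have "leaf V = prepend2 (x # p) (leaf Z)" using Cons.prems by (simp add: prod_eq_iff)
    then show ?thesis using leaf_heads_neq[OF assms(2)] by simp
  next
    case (Cons y q')
    have e: "case_nat x F = case_nat y G \<longleftrightarrow> x = y \<and> F = G" for F G :: "nat \<Rightarrow> 'a letter"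
      by (auto simp: fun_eq_iff split: nat.splits)
    have "x = y" "prepend2 p (leaf Z) = prepend2 q' (leaf V)"
      using Cons.prems unfolding Cons by (simp_all add: prod_eq_iff e)
    then show ?thesis using Cons.IH Cons by blast
  qed
qed

lemma act_inv_act:
  assumes "g \<in> carrier (free_group A)" "X \<in> boundary A"
  shows "act (inv\<^bsub>free_group A\<^esub> g) (act g X) = X"
proof -
  interpret group "free_group A" by (rule free_group_group)
  show ?thesis using act_mult[of "inv\<^bsub>free_group A\<^esub> g" A g X] assms by (simp add: act_one)
qed

lemma act2_inv_act2:
  assumes "g \<in> carrier (free_group A)" "P \<in> boundary2 A"
  shows "act2 (inv\<^bsub>free_group A\<^esub> g) (act2 g P) = P"
  using assms by (auto simp: act2_def boundary2_def act_inv_act)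

lemma act2_mult:
  assumes "u \<in> carrier (free_group A)" "v \<in> carrier (free_group A)" "P \<in> boundary2 A"
  shows "act2 (u \<otimes>\<^bsub>free_group A\<^esub> v) P = act2 u (act2 v P)"
  using assms by (auto simp: act2_def boundary2_def act_mult)

lemma act2_boundary2:
  assumes "g \<in> carrier (free_group A)" "P \<in> boundary2 A"
  shows "act2 g P \<in> boundary2 A"
proof -
  obtain X Y where P: "P = (X, Y)" "X \<in> boundary A" "Y \<in> boundary A" "X \<noteq> Y"
    using assms by (auto simp: boundary2_def)
  have "act g X \<noteq> act g Y" using P act_inv_act[OF assms(1)] by metis
  then show ?thesis using P by (simp add: act2_def boundary2_def act_boundary[OF assms(1)])
qed

lemma subshiftD:
  assumes "subshift A S"
  shows "S \<subseteq> biinf A" "S \<noteq> {}" "Z \<in> S \<Longrightarrow> shift m Z \<in> S" "Z \<in> S \<Longrightarrow> reverse Z \<in> S"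
    "Z \<in> biinf A \<Longrightarrow> (\<And>k. \<exists>Z'\<in>S. agree k Z Z') \<Longrightarrow> Z \<in> S"
  using assms by (auto simp: subshift_def)

lemma mem_orbitI:
  "Z \<in> S \<Longrightarrow> g \<in> carrier (free_group A) \<Longrightarrow> act2 g (leaf Z) \<in> orbit A S"
  by (auto simp: orbit_def)

lemma Nil_carrier: "[] \<in> carrier (free_group A)"
  by (simp add: free_group_def)

lemma leaf_mem_orbit: "Z \<in> S \<Longrightarrow> leaf Z \<in> orbit A S"
  using mem_orbitI[OF _ Nil_carrier, of Z S A] by (simp add: act2_def act_def prod.map_ident_strong)

text \<open>The way back from pairs to words: a group element turns a leaf into a prefixed leaf of a
  shift, and the uniqueness of that form identifies \<open>V\<close> with this shift.\<close>

lemma orbit_base_mem: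
  assumes "subshift A S" "V \<in> biinf A" "prepend2 p (leaf V) \<in> orbit A S"
  shows "V \<in> S"
proof -
  obtain g Z where gZ: "Z \<in> S" "prepend2 p (leaf V) = act2 g (leaf Z)"
    using assms(3) by (auto simp: orbit_def)
  have "Z \<in> biinf A" using gZ subshiftD(1)[OF assms(1)] by auto
  then obtain q m where "prepend2 p (leaf V) = prepend2 q (leaf (shift m Z))"
    using act_orbit_form[of Z A g] gZ by auto
  then have "V = shift m Z"
    using prepend2_leaf_unique[OF assms(2) shift_biinf[OF \<open>Z \<in> biinf A\<close>]] by blast
  then show ?thesis using subshiftD(3)[OF assms(1) gZ(1)] by simp
qed

lemma words_of_orbit:
  assumes "subshift A S" shows "words_of A (orbit A S) = S"
  using orbit_base_mem[OF assms, of _ "[]"] subshiftD(1)[OF assms] leaf_mem_orbit[of _ S A]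
  by (auto simp: words_of_def prod.map_ident_strong prepend_def)

lemma orbit_subset: "S \<subseteq> biinf A \<Longrightarrow> orbit A S \<subseteq> boundary2 A"
  by (auto simp: orbit_def subset_iff leaf_boundary2 intro!: act2_boundary2)

section \<open>Distances between pairs and agreement of windows\<close>

lemma bd2_dist_le_iff:
  "bd2_dist P Q \<le> exp (- real k) \<longleftrightarrow> (\<forall>i<k. fst P i = fst Q i \<and> snd P i = snd Q i)"
  unfolding bd2_dist_def by (auto simp: bd_dist_le_iff prefix_word_eq_iff)

lemma dist_prepend2_agree:
  assumes "agree k Z V"
  shows "bd2_dist (prepend2 p (leaf Z)) (prepend2 p (leaf V)) \<le> exp (- real k)"
  using assms unfolding bd2_dist_le_iff by (auto simp: prepend_nth leaf_def agree_def)

text \<open>A pair that is close enough must branch at the same place as the given one;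
  \<open>k \<ge> 1\<close> makes the letters just after the branching point visible. The remaining
  \<open>k\<close> letters of either ray give the common window.\<close>

lemma near_decomp:
  assumes "Z \<in> biinf A" "Q \<in> boundary2 A" "k \<ge> 1"
    "bd2_dist (prepend2 p (leaf Z)) Q \<le> exp (- real (length p + k))"
  obtains V where "V \<in> biinf A" "Q = prepend2 p (leaf V)" "agree k Z V"
proof -
  obtain q V where V: "V \<in> biinf A" "Q = prepend2 q (leaf V)"
    using boundary2_decomp[OF assms(2)] by metis
  have eq: "prepend p (fst (leaf Z)) i = prepend q (fst (leaf V)) i"
    "prepend p (snd (leaf Z)) i = prepend q (snd (leaf V)) i" if "i < length p + k" for i
    using assms(4) that unfolding bd2_dist_le_iff V(2) by auto
  have "\<not> length q < length p"
    using eq[of "length q"] leaf_heads_neq[OF V(1)] by (auto simp: prepend_nth)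
  moreover have "\<not> length p < length q"
    using eq[of "length p"] leaf_heads_neq[OF assms(1)] \<open>k \<ge> 1\<close> by (auto simp: prepend_nth)
  ultimately have len: "length q = length p" by simp
  have "p ! i = q ! i" if "i < length p" for i using eq(1)[of i] that len by (simp add: prepend_nth)
  then have "p = q" using len by (simp add: list_eq_iff_nth_eq)
  have *: "fst (leaf Z) i = fst (leaf V) i" "snd (leaf Z) i = snd (leaf V) i" if "i < k" for i
    using eq[of "length p + i"] that len by (simp_all add: prepend_nth)
  have "agree k Z V"
    unfolding agree_def
  proof (intro allI impI)
    fix i assume i: "- int k \<le> i \<and> i < int k"
    show "Z i = V i"
      using *(1)[of "nat (- 1 - i)"] *(2)[of "nat i"] i by (cases "i \<ge> 0") (auto simp: leaf_def)
  qed
  then show thesis using that V \<open>p = q\<close> by blast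
qed

lemma exp_neg_less:
  assumes "(r::real) > 0" obtains k where "k \<ge> k0" "exp (- real k) < r"
proof -
  obtain n where "- ln r < real n" using reals_Archimedean2 by blast
  then have "- real (max n k0) < ln r" by simp
  then have "exp (- real (max n k0)) < exp (ln r)" by (simp only: exp_less_cancel_iff)
  then show thesis using that[of "max n k0"] assms by simp
qed

lemma algebraic_laminationI:
  assumes "L \<subseteq> boundary2 A" "L \<noteq> {}"
    "closedin (Metric_space.mtopology (boundary2 A) bd2_dist) L"
    "\<And>P. P \<in> L \<Longrightarrow> prod.swap P \<in> L"
    "\<And>w P. w \<in> carrier (free_group A) \<Longrightarrow> P \<in> L \<Longrightarrow> act2 w P \<in> L"
  shows "L \<in> algebraic_laminations A"
  using assms by (fastforce simp: algebraic_laminations_def act2_def)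

lemma algebraic_laminationD:
  assumes "L \<in> algebraic_laminations A"
  shows "L \<subseteq> boundary2 A" "L \<noteq> {}"
    "closedin (Metric_space.mtopology (boundary2 A) bd2_dist) L"
    "P \<in> L \<Longrightarrow> prod.swap P \<in> L"
    "w \<in> carrier (free_group A) \<Longrightarrow> P \<in> L \<Longrightarrow> act2 w P \<in> L"
  using assms by (cases P; force simp: algebraic_laminations_def act2_def)+

lemma swap_act2: "prod.swap (act2 g P) = act2 g (prod.swap P)"
  by (simp add: act2_def prod_eq_iff)

lemma orbit_lamination:
  assumes S: "subshift A S"
  shows "orbit A S \<in> algebraic_laminations A"
proof (rule algebraic_laminationI)
  interpret Metric_space "boundary2 A" bd2_dist by (rule Metric_space_boundary2)
  interpret G: group "free_group A" by (rule free_group_group)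
  note SA = subshiftD(1)[OF S]
  show sub: "orbit A S \<subseteq> boundary2 A" using orbit_subset[OF SA] .
  show "orbit A S \<noteq> {}" using subshiftD(2)[OF S] leaf_mem_orbit by fastforce
  show "prod.swap P \<in> orbit A S" if "P \<in> orbit A S" for P
  proof -
    obtain g Z where gZ: "P = act2 g (leaf Z)" "g \<in> carrier (free_group A)" "Z \<in> S"
      using \<open>P \<in> orbit A S\<close> by (auto simp: orbit_def)
    then show ?thesis
      using mem_orbitI[OF subshiftD(4)[OF S gZ(3)] gZ(2)] by (simp add: swap_act2 leaf_reverse)
  qed
  show "act2 w P \<in> orbit A S" if "w \<in> carrier (free_group A)" "P \<in> orbit A S" for w P
  proof -
    obtain g Z where gZ: "P = act2 g (leaf Z)" "g \<in> carrier (free_group A)" "Z \<in> S"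
      using \<open>P \<in> orbit A S\<close> by (auto simp: orbit_def)
    have "act2 w P = act2 (w \<otimes>\<^bsub>free_group A\<^esub> g) (leaf Z)"
      unfolding gZ(1) using act2_mult[OF that(1) gZ(2) leaf_boundary2] gZ(3) SA by (metis subsetD)
    then show ?thesis using mem_orbitI[OF gZ(3)] G.m_closed[OF that(1) gZ(2)] by simp
  qed
  show "closedin mtopology (orbit A S)"
    unfolding closedin_metric
  proof (intro conjI allI impI sub)
    fix P assume P: "P \<in> boundary2 A - orbit A S"
    obtain p Z where Z: "Z \<in> biinf A" "p \<in> carrier (free_group A)" "P = prepend2 p (leaf Z)"
      using boundary2_decomp[of P A] P by (metis DiffD1)
    have "act2 p (leaf Z) = P" using prepend2_eq_act2[of p "leaf Z" A "leaf Z"] P Z(3) by auto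
    then have "Z \<notin> S" using P Z(2) mem_orbitI[of Z S p A] by auto
    then obtain k where k: "\<forall>Z'\<in>S. \<not> agree k Z Z'" using subshiftD(5)[OF S Z(1)] by blast
    \<comment> \<open>The radius accounts for the common prefix and the excluded window. The
      successor supplies the positive radius required by \<open>near_decomp\<close>.\<close>
    have "disjnt (orbit A S) (mball P (exp (- real (length p + Suc k))))"
    proof -
      have False if Q: "Q \<in> orbit A S" "bd2_dist P Q < exp (- real (length p + Suc k))" for Q
      proof -
        obtain V where V: "V \<in> biinf A" "Q = prepend2 p (leaf V)" "agree (Suc k) Z V"
          using near_decomp[of Z A Q "Suc k" p] Z Q sub by auto
        have "V \<in> S" using orbit_base_mem[OF S V(1)] V(2) Q(1) by blast
        then show False using k agree_mono[OF V(3)] by auto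
      qed
      then show ?thesis by (auto simp: disjnt_iff)
    qed
    then show "\<exists>r>0. disjnt (orbit A S) (mball P r)" by (meson exp_gt_zero)
  qed
qed

lemma leaf_shift_1:
  assumes "Z \<in> biinf A"
  shows "leaf (shift 1 Z) = act2 [inv_letter (Z 0)] (leaf Z)"
    and "leaf (shift (- 1) Z) = act2 [Z (- 1)] (leaf Z)"
proof -
  have "Z (- 1) \<noteq> inv_letter (Z 0)"
    using biinfD(2)[OF assms, of 0 "- 1"] by auto
  moreover have "inv_letter (Z (- 1)) \<noteq> Z 0"
    using biinfD(2)[OF assms, of 0 "- 1"] by auto
  ultimately show "leaf (shift 1 Z) = act2 [inv_letter (Z 0)] (leaf Z)"
    "leaf (shift (- 1) Z) = act2 [Z (- 1)] (leaf Z)"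
    by (auto simp: act2_def act_def lcons_inf_def leaf_def shift_def fun_eq_iff algebra_simps
        split: nat.splits)
qed

lemma letter_carrier: "x \<in> A \<times> UNIV \<Longrightarrow> [x] \<in> carrier (free_group A)"
  by (simp add: free_group_def reduced_def del: mem_Sigma_iff)

text \<open>Sliding the base point along the geodesic is multiplication by the letters crossed, one
  at a time. In this way invariance under the group gives invariance under shifts.\<close>

lemma leaf_shift:
  assumes Z: "Z \<in> biinf A"
  shows "\<exists>u\<in>carrier (free_group A). leaf (shift m Z) = act2 u (leaf Z)"
proof -
  interpret group "free_group A" by (rule free_group_group)
  have step: "\<exists>u\<in>carrier (free_group A). leaf V = act2 u (leaf Z)"
    if x: "x \<in> A \<times> UNIV" and V: "leaf V = act2 [x] (leaf U)"
      and U: "\<exists>u\<in>carrier (free_group A). leaf U = act2 u (leaf Z)" for x U V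
  proof -
    obtain u where u: "u \<in> carrier (free_group A)" "leaf U = act2 u (leaf Z)" using U by blast
    have "leaf V = act2 ([x] \<otimes>\<^bsub>free_group A\<^esub> u) (leaf Z)"
      unfolding V u(2) using act2_mult[OF letter_carrier[OF x] u(1) leaf_boundary2[OF Z]] by simp
    then show ?thesis using m_closed[OF letter_carrier[OF x] u(1)] by blast
  qed
  show ?thesis
  proof (induction m rule: int_induct[where k = 0])
    case base
    have "leaf (shift 0 Z) = act2 [] (leaf Z)" by (simp add: act2_def act_def prod.map_ident_strong)
    then show ?case using Nil_carrier by blast
  next
    case (step1 i)
    have V: "shift i Z \<in> biinf A" using shift_biinf[OF Z] .
    have "inv_letter (shift i Z 0) \<in> A \<times> UNIV" unfolding inv_letter_in_iff by (rule biinfD(1)[OF V])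
    from step[OF this leaf_shift_1(1)[OF V] step1(2)] show ?case by (simp add: add.commute)
  next
    case (step2 i)
    have V: "shift i Z \<in> biinf A" using shift_biinf[OF Z] .
    from step[OF biinfD(1)[OF V] leaf_shift_1(2)[OF V] step2(2)] show ?case by (simp add: add.commute)
  qed
qed

text \<open>Translating by the inverse of the common prefix moves any pair of \<open>L\<close> to a
  leaf through \<open>1\<close>, so \<open>L\<close> is recovered from its words. Together with
  \<open>words_of_orbit\<close> this makes laminations and subshifts correspond bijectively.\<close>

lemma subshift_words_of:
  assumes L: "L \<in> algebraic_laminations A"
  shows "subshift A (words_of A L)" "orbit A (words_of A L) = L"
proof -
  interpret Metric_space "boundary2 A" bd2_dist by (rule Metric_space_boundary2)
  interpret G: group "free_group A" by (rule free_group_group)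
  note LD = algebraic_laminationD[OF L]
  have sh: "shift m Z \<in> words_of A L" if Z: "Z \<in> words_of A L" for m Z
  proof -
    have Z: "Z \<in> biinf A" "leaf Z \<in> L" using Z by (auto simp: words_of_def)
    obtain u where "u \<in> carrier (free_group A)" "leaf (shift m Z) = act2 u (leaf Z)"
      using leaf_shift[OF Z(1)] by blast
    then show ?thesis using LD(5)[OF _ Z(2)] shift_biinf[OF Z(1)] by (simp add: words_of_def)
  qed
  have base: "\<exists>p Z. P = act2 p (leaf Z) \<and> p \<in> carrier (free_group A) \<and> Z \<in> words_of A L"
    if "P \<in> L" for P
  proof -
    have "P \<in> boundary2 A" using that LD(1) by auto
    then obtain p Z where Z: "Z \<in> biinf A" "p \<in> carrier (free_group A)" "P = prepend2 p (leaf Z)"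
      using boundary2_decomp by metis
    have P: "P = act2 p (leaf Z)" using prepend2_eq_act2[of p "leaf Z" A "leaf Z"] Z(3) \<open>P \<in> boundary2 A\<close> by simp
    have "leaf Z = act2 (inv\<^bsub>free_group A\<^esub> p) P"
      unfolding P using act2_inv_act2[OF Z(2) leaf_boundary2[OF Z(1)]] by simp
    then have "leaf Z \<in> L" using LD(5)[OF _ that, of "inv\<^bsub>free_group A\<^esub> p"] Z(2) by simp
    then show ?thesis using P Z by (auto simp: words_of_def)
  qed
  show "subshift A (words_of A L)"
    unfolding subshift_def
  proof (intro conjI ballI allI impI sh)
    show "words_of A L \<subseteq> biinf A" by (auto simp: words_of_def)
    show "words_of A L \<noteq> {}" using base LD(2) by fastforce
    show "reverse Z \<in> words_of A L" if "Z \<in> words_of A L" for Z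
      using that LD(4)[of "leaf Z"] by (simp add: words_of_def reverse_biinf leaf_reverse)
    show "Z \<in> words_of A L" if Z: "Z \<in> biinf A" "\<forall>k. \<exists>Z'\<in>words_of A L. agree k Z Z'" for Z
    proof (rule ccontr)
      assume "Z \<notin> words_of A L"
      then have "leaf Z \<in> boundary2 A - L" using Z leaf_boundary2 by (auto simp: words_of_def)
      then obtain r where r: "r > 0" "disjnt L (mball (leaf Z) r)"
        using LD(3) unfolding closedin_metric by blast
      obtain k where k: "exp (- real k) < r" using exp_neg_less[OF r(1)] by blast
      obtain Z' where Z': "Z' \<in> words_of A L" "agree k Z Z'" using Z(2) by blast
      have "bd2_dist (leaf Z) (leaf Z') \<le> exp (- real k)"
        using dist_prepend2_agree[OF Z'(2), of "[]"] by (simp add: prod.map_ident_strong)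
      moreover have "leaf Z' \<in> L" using Z'(1) by (simp add: words_of_def)
      ultimately have "leaf Z' \<in> mball (leaf Z) r" using k LD(1) leaf_boundary2[OF Z(1)] by auto
      then show False using r(2) \<open>leaf Z' \<in> L\<close> unfolding disjnt_iff by blast
    qed
  qed
  show "orbit A (words_of A L) = L"
  proof
    show "orbit A (words_of A L) \<subseteq> L" unfolding orbit_def words_of_def using LD(5) by blast
    show "L \<subseteq> orbit A (words_of A L)" using base unfolding orbit_def by blast
  qed
qed

section \<open>Hausdorff distance and windows\<close>

lemma hausdorff_le:
  fixes d :: "'b \<Rightarrow> 'b \<Rightarrow> real"
  assumes "S \<noteq> {}" "T \<noteq> {}" "\<And>x y. 0 \<le> d x y"
    "\<And>x. x \<in> S \<Longrightarrow> \<exists>y\<in>T. d x y \<le> e" "\<And>y. y \<in> T \<Longrightarrow> \<exists>x\<in>S. d x y \<le> e"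
  shows "hausdorff_dist d S T \<le> e"
proof -
  have bb: "bdd_below (f ` X)" if "\<And>x. 0 \<le> f x" for f :: "'b \<Rightarrow> real" and X
    by (rule bdd_belowI[of _ 0]) (use that in auto)
  have "(SUP x\<in>S. INF y\<in>T. d x y) \<le> e"
    by (intro cSUP_least assms(1)) (meson assms(3,4) bb cINF_lower2)
  moreover have "(SUP y\<in>T. INF x\<in>S. d x y) \<le> e"
    by (intro cSUP_least assms(2)) (meson assms(3,5) bb cINF_lower2)
  ultimately show ?thesis by (simp add: hausdorff_dist_def assms(1,2))
qed

text \<open>The bound \<open>1\<close> on \<open>d\<close> keeps the outer supremum bounded above,
  so that it really dominates each infimum.\<close>

lemma hausdorff_less_ex:
  fixes d :: "'b \<Rightarrow> 'b \<Rightarrow> real"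
  assumes "T \<noteq> {}" "\<And>x y. 0 \<le> d x y" "\<And>x y. d x y \<le> 1" "hausdorff_dist d S T < e" "x \<in> S"
  shows "\<exists>y\<in>T. d x y < e"
proof -
  have bb: "bdd_below (d x ` T)" for x by (rule bdd_belowI[of _ 0]) (use assms in auto)
  obtain y0 where y0: "y0 \<in> T" using assms(1) by auto
  have "(INF y\<in>T. d x y) \<le> 1" for x using cINF_lower[OF bb y0, of x] assms(3)[of x y0] by linarith
  then have "bdd_above ((\<lambda>x. INF y\<in>T. d x y) ` S)" by (intro bdd_aboveI[of _ 1]) auto
  then have "(INF y\<in>T. d x y) \<le> (SUP x\<in>S. INF y\<in>T. d x y)" by (rule cSUP_upper[OF assms(5)])
  also have "\<dots> < e" using assms by (auto simp: hausdorff_dist_def split: if_splits)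
  finally show ?thesis using cINF_less_iff[OF assms(1) bb] by blast
qed

text \<open>A pair with prefix \<open>p\<close> is approximated by the same \<open>p\<close> in
  front of a word with the same window. Since \<open>k \<ge> 1\<close>, the heads agree, so
  \<open>p\<close> acts on the new leaf without cancellation and the new pair stays in the
  orbit.\<close>

lemma hausdorff_orbit_le:
  assumes S: "subshift A S" and T: "subshift A T" and k: "k \<ge> 1"
    and ST: "\<And>Z. Z \<in> S \<Longrightarrow> \<exists>V\<in>T. agree k Z V" and TS: "\<And>V. V \<in> T \<Longrightarrow> \<exists>Z\<in>S. agree k Z V"
  shows "hausdorff_dist bd2_dist (orbit A S) (orbit A T) \<le> exp (- real k)"
proof -
  have *: "\<exists>Q\<in>orbit A T. bd2_dist P Q \<le> exp (- real k)"
    if S: "subshift A S" and T: "subshift A T" and ST: "\<And>Z. Z \<in> S \<Longrightarrow> \<exists>V\<in>T. agree k Z V"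
      and P: "P \<in> orbit A S" for S T P
  proof -
    have "P \<in> boundary2 A" using P orbit_subset[OF subshiftD(1)[OF S]] by auto
    then obtain p Z where Z: "Z \<in> biinf A" "p \<in> carrier (free_group A)" "P = prepend2 p (leaf Z)"
      using boundary2_decomp by metis
    have "Z \<in> S" using orbit_base_mem[OF S Z(1)] P Z(3) by simp
    then obtain V where V: "V \<in> T" "agree k Z V" using ST by blast
    define Q where "Q = prepend2 p (leaf V)"
    have d: "bd2_dist P Q \<le> exp (- real k)" using dist_prepend2_agree[OF V(2)] Z(3) by (simp add: Q_def)
    have "act2 p (leaf V) = Q"
      unfolding Q_def using prepend2_eq_act2[of p "leaf Z" A "leaf V"] V(2) Z(3) \<open>P \<in> boundary2 A\<close> k
      by (simp add: leaf_def agree_def)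
    then show ?thesis using d mem_orbitI[OF V(1) Z(2)] by auto
  qed
  show ?thesis
  proof (rule hausdorff_le)
    show "orbit A S \<noteq> {}" "orbit A T \<noteq> {}"
      using subshiftD(2)[OF S] subshiftD(2)[OF T] leaf_mem_orbit by fastforce+
    show "\<exists>Q\<in>orbit A T. bd2_dist P Q \<le> exp (- real k)" if "P \<in> orbit A S" for P
      using *[OF S T ST that] .
    show "\<exists>P\<in>orbit A S. bd2_dist P Q \<le> exp (- real k)" if "Q \<in> orbit A T" for Q
      using *[OF T S _ that] TS agree_sym bd2_dist_commute by metis
  qed simp
qed

section \<open>Compactness\<close>

lemma finite_windows:
  assumes "finite A"
  shows "finite ((\<lambda>Z. map Z [- int k..int k - 1]) ` biinf A)"
proof (rule finite_subset)
  show "finite {xs. set xs \<subseteq> A \<times> (UNIV :: bool set) \<and> length xs = 2 * k}"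
    using assms by (intro finite_lists_length_eq) simp
  show "(\<lambda>Z. map Z [- int k..int k - 1]) ` biinf A \<subseteq> {xs. set xs \<subseteq> A \<times> UNIV \<and> length xs = 2 * k}"
  proof (intro image_subsetI CollectI conjI)
    fix Z assume "Z \<in> biinf A"
    then show "set (map Z [- int k..int k - 1]) \<subseteq> A \<times> UNIV"
      using biinfD(1)[of Z A] by (simp add: image_subset_iff del: mem_Sigma_iff)
  qed simp
qed

lemma agree_iff_window: "agree k Z V \<longleftrightarrow> map Z [- int k..int k - 1] = map V [- int k..int k - 1]"
  by (auto simp: agree_def)

lemma biinf_pigeonhole:
  assumes "finite A" "infinite N" "\<And>n. n \<in> N \<Longrightarrow> f n \<in> biinf A"
  shows "\<exists>M\<subseteq>N. infinite M \<and> (\<forall>m\<in>M. \<forall>n\<in>M. agree k (f m) (f n))"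
proof -
  let ?w = "\<lambda>n. map (f n) [- int k..int k - 1]"
  have "finite (?w ` N)"
    by (rule finite_subset[OF _ finite_windows[OF assms(1), of k]]) (use assms(3) in auto)
  then obtain y where "infinite (?w -` {y} \<inter> N)" using inf_img_fin_dom'[OF _ assms(2)] by metis
  then show ?thesis
    by (intro exI[of _ "?w -` {y} \<inter> N"]) (auto simp only: agree_iff_window vimage_def)
qed

text \<open>Sequential compactness by diagonal extraction. The conclusion asks for infinitely many
  indices, so that every window of the limit is found at arbitrarily late indices.\<close>

lemma biinf_limit:
  assumes A: "finite A" and f: "\<And>n::nat. f n \<in> biinf A"
  obtains V where "V \<in> biinf A" "\<And>k. infinite {n. agree k V (f n)}"
proof -
  let ?P = "\<lambda>k N. infinite N \<and> (\<forall>m\<in>N. \<forall>n\<in>N. agree k (f m) (f n))"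
  have "\<exists>N. \<forall>k. ?P k (N k) \<and> N (Suc k) \<subseteq> N k"
  proof (rule dependent_nat_choice[where P = ?P and Q = "\<lambda>_ N M. M \<subseteq> N"])
    show "\<exists>N. ?P 0 N" by (rule exI[of _ UNIV]) (auto simp: agree_def)
    show "\<exists>M. ?P (Suc k) M \<and> M \<subseteq> N" if "?P k N" for N k
      using biinf_pigeonhole[OF A, of N f "Suc k"] that f by blast
  qed
  then obtain N where N: "\<And>k. ?P k (N k)" "\<And>k. N (Suc k) \<subseteq> N k" by metis
  have dec: "N k \<subseteq> N j" if "j \<le> k" for j k using lift_Suc_antimono_le[of N, OF N(2) that] .
  define \<nu> where "\<nu> k = (SOME n. n \<in> N k)" for k
  have \<nu>: "\<nu> k \<in> N k" for k
    unfolding \<nu>_def some_in_eq using N(1)[of k] infinite_imp_nonempty by blast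
  \<comment> \<open>The least radius whose window contains \<open>i\<close>; the window is
    half-open, hence the asymmetry between the two signs.\<close>
  define l where "l i = nat (if i < 0 then - i else i + 1)" for i :: int
  define V where "V i = f (\<nu> (l i)) i" for i
  have ag: "agree k V (f n)" if "n \<in> N k" for k n
    unfolding agree_def
  proof (intro allI impI)
    fix i assume i: "- int k \<le> i \<and> i < int k"
    then have "l i \<le> k" by (auto simp: l_def)
    then have "n \<in> N (l i)" using that dec by auto
    then have "agree (l i) (f (\<nu> (l i))) (f n)" using N(1) \<nu> by blast
    moreover have "- int (l i) \<le> i \<and> i < int (l i)" by (auto simp: l_def)
    ultimately show "V i = f n i" by (simp add: agree_def V_def)
  qed
  have inf: "infinite {n. agree k V (f n)}" for k
    using N(1)[of k] ag[of _ k] by (meson infinite_super mem_Collect_eq subsetI)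
  have "V \<in> biinf A"
  proof (rule biinfI)
    fix i
    let ?k = "Suc (nat \<bar>i\<bar> + 1)"
    obtain n where "agree ?k V (f n)" using inf[of ?k] by (auto dest: infinite_imp_nonempty)
    then have "V i = f n i" "V (i + 1) = f n (i + 1)" by (rule agreeD; simp)+
    then show "V i \<in> A \<times> UNIV" "V (i + 1) \<noteq> inv_letter (V i)"
      using biinfD[OF f[of n]] by (simp_all del: mem_Sigma_iff)
  qed
  then show thesis using that inf by blast
qed

section \<open>Recurrence in minimal subshifts\<close>

definition minimal_subshift :: "'a set \<Rightarrow> (int \<Rightarrow> 'a letter) set \<Rightarrow> bool" where
  "minimal_subshift A W \<longleftrightarrow> subshift A W \<and> (\<forall>S. subshift A S \<and> S \<subseteq> W \<longrightarrow> S = W)"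

lemma minimal_lamination_subshift:
  assumes "minimal_lamination A L"
  shows "minimal_subshift A (words_of A L)"
  unfolding minimal_subshift_def
proof (intro conjI allI impI)
  have L: "L \<in> algebraic_laminations A" using assms by (simp add: minimal_lamination_def)
  show "subshift A (words_of A L)" by (rule subshift_words_of[OF L])
  fix S assume S: "subshift A S \<and> S \<subseteq> words_of A L"
  then have "orbit A S \<subseteq> orbit A (words_of A L)" by (auto simp: orbit_def)
  then have "orbit A S \<subseteq> L" using subshift_words_of(2)[OF L] by simp
  then have "orbit A S = L"
    using assms orbit_lamination S unfolding minimal_lamination_def by blast
  then show "S = words_of A L" using words_of_orbit S by metis
qed

text \<open>Otherwise the words of \<open>W\<close> that nowhere show the window of \<open>U\<close>
  or of its reversal would form a subshift inside \<open>W\<close> that misses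
  \<open>U\<close>.\<close>

lemma minimal_subshift_recurrent:
  assumes A: "finite A" and W: "minimal_subshift A W" and ZU: "Z \<in> W" "U \<in> W"
  shows "\<exists>m\<ge>N. agree k U (shift m Z) \<or> agree k (reverse U) (shift m Z)"
proof (rule ccontr)
  assume neg: "\<not> ?thesis"
  have sub: "subshift A W" and min: "\<And>S. subshift A S \<Longrightarrow> S \<subseteq> W \<Longrightarrow> S = W"
    using W by (auto simp: minimal_subshift_def)
  note WD = subshiftD[OF sub]
  \<comment> \<open>Forbidding both orientations makes the avoiding set closed under
    \<open>reverse\<close>.\<close>
  define bad where "bad V m \<longleftrightarrow> agree k U (shift m V) \<or> agree k (reverse U) (shift m V)" for V m
  define S where "S = {V \<in> W. \<forall>m. \<not> bad V m}"
  have bad_shift: "bad (shift j V) m \<longleftrightarrow> bad V (m + j)" for V j m by (simp add: bad_def)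
  have bad_reverse: "bad (reverse V) m \<longleftrightarrow> bad V (- m)" for V m
    using agree_reverse[of k U "shift (- m) V"] agree_reverse[of k "reverse U" "shift (- m) V"]
    by (auto simp: bad_def reverse_shift)
  have bad_agree: "bad V m \<longleftrightarrow> bad V' m" if "agree (k + nat \<bar>m\<bar>) V V'" for V V' m
    using agree_shift[OF that] agree_trans agree_sym unfolding bad_def by metis
  have "subshift A S"
    unfolding subshift_def
  proof (intro conjI ballI allI impI)
    show "S \<subseteq> biinf A" using WD(1) by (auto simp: S_def)
    show "shift m V \<in> S" if "V \<in> S" for V m using that WD(3) by (simp add: S_def bad_shift)
    show "reverse V \<in> S" if "V \<in> S" for V using that WD(4) by (simp add: S_def bad_reverse)
    show "V \<in> S" if V: "V \<in> biinf A" "\<forall>k. \<exists>V'\<in>S. agree k V V'" for V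
    proof -
      have "V \<in> W" using WD(5)[OF V(1)] V(2) unfolding S_def by blast
      moreover have "\<not> bad V m" for m
        using V(2)[rule_format, of "k + nat \<bar>m\<bar>"] bad_agree by (auto simp: S_def)
      ultimately show ?thesis by (simp add: S_def)
    qed
    \<comment> \<open>Windows of the limit around \<open>m\<close> are read in \<open>Z\<close>
      around \<open>m + n\<close> for arbitrarily large \<open>n\<close>. Absence from
      \<open>N\<close> onwards in \<open>Z\<close> thus becomes absence everywhere, and the avoiding
      set is not empty.\<close>
    obtain V where V: "V \<in> biinf A" "\<And>k. infinite {n. agree k V (shift (int n) Z)}"
      using biinf_limit[OF A, of "\<lambda>n. shift (int n) Z"] WD(1) ZU(1) shift_biinf by blast
    have "V \<in> W"
    proof (rule WD(5)[OF V(1)])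
      show "\<exists>V'\<in>W. agree j V V'" for j
        using V(2)[of j] WD(3)[OF ZU(1)] by (auto dest: infinite_imp_nonempty)
    qed
    moreover have "\<not> bad V m" for m
    proof
      assume "bad V m"
      obtain n where n: "n \<ge> nat (\<bar>N\<bar> + \<bar>m\<bar>)" "agree (k + nat \<bar>m\<bar>) V (shift (int n) Z)"
        using V(2)[of "k + nat \<bar>m\<bar>"] unfolding infinite_nat_iff_unbounded_le by blast
      have "bad Z (m + int n)" using bad_agree[OF n(2)] \<open>bad V m\<close> by (simp add: bad_shift)
      moreover have "m + int n \<ge> N" using n(1) by linarith
      ultimately show False using neg unfolding bad_def by blast
    qed
    ultimately show "S \<noteq> {}" by (auto simp: S_def)
  qed
  then have "S = W" using min by (auto simp: S_def)
  moreover have "bad U 0" by (simp add: bad_def agree_def)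
  ultimately show False using ZU(2) by (auto simp: S_def)
qed

section \<open>Periodic words\<close>

definition periodic :: "'b list \<Rightarrow> int \<Rightarrow> 'b" where
  "periodic c i = c ! nat (i mod int (length c))"

definition periodic_subshift :: "'a letter list \<Rightarrow> (int \<Rightarrow> 'a letter) set" where
  "periodic_subshift c = range (\<lambda>m. shift m (periodic c)) \<union> range (\<lambda>m. reverse (shift m (periodic c)))"

lemma periodic_add: "periodic c (i + int (length c)) = periodic c i"
  by (simp add: periodic_def)

text \<open>The condition \<open>reduced (c @ c)\<close> expresses cyclic reducedness: besides
  \<open>c\<close> itself it covers the seam between two copies.\<close>

lemma periodic_biinf:
  assumes "c \<noteq> []" "set c \<subseteq> A \<times> UNIV" "reduced (c @ c)"
  shows "periodic c \<in> biinf A"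
proof (rule biinfI)
  let ?p = "length c"
  fix i
  define r where "r = nat (i mod int ?p)"
  have r: "r < ?p" "int r = i mod int ?p" using assms(1) by (simp_all add: r_def nat_less_iff)
  have i: "periodic c i = c ! r" by (simp add: periodic_def r_def)
  then show "periodic c i \<in> A \<times> UNIV" using r assms(2) nth_mem by (metis subsetD)
  have "(i + 1) mod int ?p = int (Suc r) mod int ?p" unfolding of_nat_Suc r by (simp add: mod_simps add.commute)
  also have "\<dots> = int (Suc r mod ?p)" by (simp add: zmod_int)
  finally have "periodic c (i + 1) = c ! (Suc r mod ?p)" by (simp add: periodic_def)
  then have "periodic c (i + 1) = (c @ c) ! Suc r"
    using r(1) by (cases "Suc r = ?p") (auto simp: nth_append)
  moreover have "(c @ c) ! Suc r \<noteq> inv_letter ((c @ c) ! r)"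
    using assms(3) r(1) unfolding reduced_def successively_conv_nth by auto
  moreover have "(c @ c) ! r = c ! r" using r by (simp add: nth_append)
  ultimately show "periodic c (i + 1) \<noteq> inv_letter (periodic c i)" using i by simp
qed

text \<open>Shifts matter only modulo the length of \<open>c\<close>, so the set is finite. A window
  that shows, for each member, a place where \<open>Z\<close> differs from it excludes all of them
  at once; this gives closedness.\<close>

lemma subshift_periodic:
  assumes c: "c \<noteq> []" "set c \<subseteq> A \<times> UNIV" "reduced (c @ c)"
  shows "subshift A (periodic_subshift c)"
  unfolding subshift_def
proof (intro conjI ballI allI impI)
  let ?S = "periodic_subshift c"
  show sub: "?S \<subseteq> biinf A"
    using shift_biinf[OF periodic_biinf[OF c]] reverse_biinf by (auto simp: periodic_subshift_def)
  show "?S \<noteq> {}" by (simp add: periodic_subshift_def)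
  show "shift m Z \<in> ?S" if "Z \<in> ?S" for Z m
  proof -
    consider j where "Z = shift j (periodic c)" | j where "Z = reverse (shift j (periodic c))"
      using \<open>Z \<in> ?S\<close> by (auto simp: periodic_subshift_def)
    then show ?thesis
    proof cases
      case (2 j)
      then have "shift m Z = reverse (shift (j - m) (periodic c))" by (simp add: reverse_shift)
      then show ?thesis by (auto simp: periodic_subshift_def)
    qed (auto simp: periodic_subshift_def)
  qed
  show "reverse Z \<in> ?S" if "Z \<in> ?S" for Z
    using that by (auto simp: periodic_subshift_def)
  let ?p = "int (length c)"
  have red: "shift m (periodic c) = shift (m mod ?p) (periodic c)" for m
    by (simp add: shift_def periodic_def mod_simps)
  have "m mod ?p \<in> {0..<?p}" for m using c(1) by simp
  then have "shift m (periodic c) \<in> (\<lambda>m. shift m (periodic c)) ` {0..<?p}" for m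
    using red[of m] by (intro image_eqI[of _ _ "m mod ?p"]) blast+
  then have "?S \<subseteq> (\<lambda>m. shift m (periodic c)) ` {0..<?p} \<union>
      reverse ` (\<lambda>m. shift m (periodic c)) ` {0..<?p}"
    unfolding periodic_subshift_def by blast
  then have fin: "finite ?S" by (rule finite_subset) simp
  show "Z \<in> ?S" if Z: "Z \<in> biinf A" "\<forall>k. \<exists>Z'\<in>?S. agree k Z Z'" for Z
  proof (rule ccontr)
    assume "Z \<notin> ?S"
    then have "\<forall>Z'\<in>?S. \<exists>i. Z i \<noteq> Z' i" by (metis ext)
    then obtain i where i: "\<And>Z'. Z' \<in> ?S \<Longrightarrow> Z (i Z') \<noteq> Z' (i Z')" by metis
    define k where "k = Suc (Max ((\<lambda>Z'. nat \<bar>i Z'\<bar>) ` ?S))"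
    obtain Z' where Z': "Z' \<in> ?S" "agree k Z Z'" using Z(2) by blast
    have "nat \<bar>i Z'\<bar> < k" unfolding k_def using fin Z'(1) by (simp add: less_Suc_eq_le)
    then have "- int k \<le> i Z' \<and> i Z' < int k" by linarith
    then show False using i[OF Z'(1)] Z'(2) unfolding agree_def by blast
  qed
qed

text \<open>If \<open>Z\<close> shows the same window of radius \<open>k\<close> at \<open>n0\<close> and at \<open>n1\<close>, then closing up \<open>Z[n0..<n1]\<close>
  creates no new window; if \<open>n1\<close> is large, recurrence makes all windows occur.\<close>

lemma minimal_subshift_periodic_approx:
  assumes A: "finite A" and W: "minimal_subshift A W" and k: "k \<ge> 1"
  obtains c where "c \<noteq> []" "set c \<subseteq> A \<times> UNIV" "reduced (c @ c)"
    "\<And>Z. Z \<in> W \<Longrightarrow> \<exists>V\<in>periodic_subshift c. agree k Z V"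
    "\<And>V. V \<in> periodic_subshift c \<Longrightarrow> \<exists>Z\<in>W. agree k Z V"
proof -
  have sub: "subshift A W" using W by (simp add: minimal_subshift_def)
  note WD = subshiftD[OF sub]
  obtain Z where Z: "Z \<in> W" using WD(2) by auto
  \<comment> \<open>These returns of a window preserve orientation, which recurrence alone would not
    guarantee.\<close>
  obtain N where N: "infinite N" "\<And>m n. m \<in> N \<Longrightarrow> n \<in> N \<Longrightarrow> agree k (shift (int m) Z) (shift (int n) Z)"
    using biinf_pigeonhole[OF A infinite_UNIV_nat, of "\<lambda>n. shift (int n) Z" k] shift_biinf[of Z A] WD(1) Z
    by (metis subsetD)
  obtain n0 where n0: "n0 \<in> N" using N(1) by (auto dest: infinite_imp_nonempty)
  let ?w = "\<lambda>Z. map Z [- int k..int k - 1]"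
  \<comment> \<open>The position is chosen for each window rather than for each word, so that only
    finitely many positions arise and they have a maximum.\<close>
  have "\<forall>w\<in>?w ` W. \<exists>m\<ge>int n0. \<forall>U\<in>W. ?w U = w \<longrightarrow> agree k U (shift m Z) \<or> agree k (reverse U) (shift m Z)"
  proof
    fix w assume "w \<in> ?w ` W"
    then obtain U where U: "U \<in> W" "w = ?w U" by auto
    obtain m where m: "m \<ge> int n0" "agree k U (shift m Z) \<or> agree k (reverse U) (shift m Z)"
      using minimal_subshift_recurrent[OF A W Z U(1)] by blast
    have "agree k U' (shift m Z) \<or> agree k (reverse U') (shift m Z)" if "?w U' = w" for U'
    proof -
      have "agree k U' U" using that U(2) by (simp only: agree_iff_window)
      then show ?thesis using m(2) agree_trans agree_reverse by metis
    qed
    then show "\<exists>m\<ge>int n0. \<forall>U\<in>W. ?w U = w \<longrightarrow> agree k U (shift m Z) \<or> agree k (reverse U) (shift m Z)"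
      using m(1) by blast
  qed
  then obtain \<mu> where \<mu>: "\<And>w. w \<in> ?w ` W \<Longrightarrow> \<mu> w \<ge> int n0"
    "\<And>U. U \<in> W \<Longrightarrow> agree k U (shift (\<mu> (?w U)) Z) \<or> agree k (reverse U) (shift (\<mu> (?w U)) Z)"
    by (metis imageI)
  have fin: "finite (?w ` W)" using finite_subset[OF image_mono[OF WD(1)] finite_windows[OF A]] .
  define M where "M = Max (\<mu> ` ?w ` W)"
  have M: "\<mu> (?w U) \<le> M" if "U \<in> W" for U
    unfolding M_def using fin that by (intro Max_ge) auto
  \<comment> \<open>All chosen positions then lie between \<open>n0\<close> and \<open>n1\<close>,
    and the period is long compared with a window, so that a window meets at most one seam.\<close>
  obtain n1 where n1: "n1 \<ge> nat \<bar>M\<bar> + n0 + 2 * k" "n1 \<in> N"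
    using N(1) unfolding infinite_nat_iff_unbounded_le by blast
  define p where "p = n1 - n0"
  have p: "int p = int n1 - int n0" "p \<ge> 2 * k" "int p + int n0 \<ge> M" using n1(1) by (auto simp: p_def)
  define c where "c = map (\<lambda>i. Z (int n0 + int i)) [0..<p]"
  have len: "length c = p" by (simp add: c_def)
  have per_in: "periodic c t = Z (int n0 + t)" if "0 \<le> t" "t < int p" for t
  proof -
    have "periodic c t = c ! nat t" using that by (simp add: periodic_def len)
    also have "\<dots> = Z (int n0 + int (nat t))"
      unfolding c_def using that by (subst nth_map) (auto simp: nat_less_iff)
    finally show ?thesis using that by simp
  qed
  have ZZ: "Z (int n0 + t) = Z (int n1 + t)" if "- int k \<le> t" "t < int k" for t
    using N(2)[OF n0 n1(2)] that by (simp add: agree_def shift_def add.commute)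
  \<comment> \<open>The repeated window extends the agreement by \<open>k\<close> letters beyond
    both ends of the period. Hence every window centred in the period, even across a seam, is a
    window of \<open>Z\<close>.\<close>
  have per: "periodic c t = Z (int n0 + t)" if t: "- int k \<le> t" "t < int p + int k" for t
  proof -
    consider "t < 0" | "0 \<le> t" "t < int p" | "t \<ge> int p" by linarith
    then show ?thesis
    proof cases
      case 1
      have "periodic c t = periodic c (t + int p)" using periodic_add[of c t] len by simp
      also have "\<dots> = Z (int n0 + (t + int p))" using 1 t p by (intro per_in) auto
      also have "\<dots> = Z (int n0 + t)" using ZZ[of t] 1 t p k by (simp add: algebra_simps)
      finally show ?thesis .
    next
      case 3
      have "periodic c t = periodic c (t - int p)" using periodic_add[of c "t - int p"] len by simp
      also have "\<dots> = Z (int n0 + (t - int p))" using 3 t p k by (intro per_in) auto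
      also have "\<dots> = Z (int n1 + (t - int p))" using 3 t by (intro ZZ) auto
      also have "int n1 + (t - int p) = int n0 + t" using p(1) by simp
      finally show ?thesis .
    qed (rule per_in)
  qed
  have win: "agree k (shift m (periodic c)) (shift (int n0 + m) Z)" if "0 \<le> m" "m \<le> int p" for m
    unfolding agree_def shift_def
  proof (intro allI impI)
    fix i assume "- int k \<le> i \<and> i < int k"
    then show "periodic c (i + m) = Z (i + (int n0 + m))"
      using per[of "i + m"] that by (simp add: algebra_simps)
  qed
  have "c \<noteq> []" using p k len by auto
  have ZA: "Z \<in> biinf A" using Z WD(1) by auto
  have "set c \<subseteq> A \<times> UNIV" using biinfD(1)[OF ZA] by (simp add: c_def image_subset_iff del: mem_Sigma_iff)
  moreover have "reduced (c @ c)"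
    unfolding reduced_def successively_conv_nth
  proof (intro allI impI)
    fix i assume i: "Suc i < length (c @ c)"
    have nth: "(c @ c) ! j = periodic c (int j)" if "j < 2 * p" for j
    proof -
      have "j mod p = (if j < p then j else j - p)"
        using that by (auto simp: le_mod_geq)
      then show ?thesis unfolding periodic_def len zmod_int[symmetric] nat_int
        using that by (simp add: nth_append len)
    qed
    \<comment> \<open>At the seam \<open>r + 1 = p\<close>, which is still in the extended range
      because \<open>k \<ge> 1\<close>; reducedness is inherited from \<open>Z\<close>.\<close>
    define r where "r = int i mod int p"
    have r: "0 \<le> r" "r < int p" using \<open>c \<noteq> []\<close> len by (auto simp: r_def)
    have "periodic c (int i) = periodic c r" by (simp add: periodic_def r_def len)
    moreover have "periodic c (int (Suc i)) = periodic c (r + 1)"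
      by (simp add: periodic_def r_def len mod_simps add.commute)
    moreover have "Z (int n0 + (r + 1)) \<noteq> inv_letter (Z (int n0 + r))"
      by (rule biinfD(2)[OF ZA]) simp
    ultimately show "(c @ c) ! Suc i \<noteq> inv_letter ((c @ c) ! i)"
      using nth[of i] nth[of "Suc i"] per[of r] per[of "r + 1"] r k i len by simp
  qed
  moreover have "\<exists>V\<in>periodic_subshift c. agree k U V" if U: "U \<in> W" for U
  proof -
    define m where "m = \<mu> (?w U) - int n0"
    have "0 \<le> m" "m \<le> int p" using \<mu>(1) M[OF U] p U by (auto simp: m_def)
    then have ag: "agree k (shift m (periodic c)) (shift (\<mu> (?w U)) Z)" using win[of m] by (simp add: m_def)
    then have "agree k U (shift m (periodic c)) \<or> agree k (reverse U) (shift m (periodic c))"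
      using \<mu>(2)[OF U] agree_trans agree_sym by metis
    then have "agree k U (shift m (periodic c)) \<or> agree k U (reverse (shift m (periodic c)))"
      using agree_reverse[of k "reverse U" "shift m (periodic c)"] by simp
    then show ?thesis by (auto simp: periodic_subshift_def)
  qed
  moreover have "\<exists>U\<in>W. agree k U V" if V: "V \<in> periodic_subshift c" for V
  proof -
    have *: "\<exists>U\<in>W. agree k U (shift m (periodic c))" for m
    proof -
      have "shift m (periodic c) = shift (m mod int p) (periodic c)"
        by (simp add: shift_def periodic_def len mod_simps)
      moreover have "0 \<le> m mod int p" "m mod int p \<le> int p"
        using \<open>c \<noteq> []\<close> len by (auto simp: less_imp_le)
      ultimately show ?thesis using win[of "m mod int p"] WD(3)[OF Z] agree_sym by metis
    qed
    show ?thesis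
      using V *  WD(4) agree_reverse unfolding periodic_subshift_def by blast
  qed
  ultimately show thesis using that \<open>c \<noteq> []\<close> by blast
qed

section \<open>Rational laminations as periodic subshifts\<close>

definition inv_word :: "'a letter list \<Rightarrow> 'a letter list" where
  "inv_word w = rev (map inv_letter w)"

lemma reduced_append:
  "reduced (u @ v) \<longleftrightarrow> reduced u \<and> reduced v \<and> (u \<noteq> [] \<longrightarrow> v \<noteq> [] \<longrightarrow> hd v \<noteq> inv_letter (last u))"
  by (auto simp: reduced_def successively_append_iff)

lemma reduced_inv_word: "reduced w \<Longrightarrow> reduced (inv_word w)"
  unfolding reduced_def inv_word_def successively_rev successively_map
  by (erule successively_mono) (auto; metis inv_letter_inv_letter)

lemma inv_word_carrier: "w \<in> carrier (free_group A) \<Longrightarrow> inv_word w \<in> carrier (free_group A)"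
  using reduced_inv_word[of w] by (auto simp: free_group_def inv_word_def inv_letter_def)

lemma inv_free_group:
  assumes "w \<in> carrier (free_group A)"
  shows "inv\<^bsub>free_group A\<^esub> w = inv_word w"
proof -
  interpret group "free_group A" by (rule free_group_group)
  have "inv_word w \<otimes>\<^bsub>free_group A\<^esub> w = \<one>\<^bsub>free_group A\<^esub>"
    by (simp add: free_group_def inv_word_def foldr_lcons_inverse)
  then show ?thesis using inv_equality inv_word_carrier assms by blast
qed

lemma mult_reduced:
  assumes "reduced (u @ v)" shows "u \<otimes>\<^bsub>free_group A\<^esub> v = u @ v"
proof -
  have "foldr lcons u v = u @ v"
    using assms by (induction u) (auto simp: reduced_Cons lcons_def)
  then show ?thesis by (simp add: free_group_def)
qed

text \<open>Mutually inverse first and last letters are stripped off into \<open>g\<close> until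
  none remain. Something is always left, since a reduced word is not \<open>x\<close> followed by
  its inverse.\<close>

lemma conj_cyclically_reduced:
  assumes "reduced w" "w \<noteq> []"
  shows "\<exists>g c. w = g @ c @ inv_word g \<and> c \<noteq> [] \<and> reduced (c @ c)"
  using assms
proof (induction w rule: length_induct)
  case (1 w)
  show ?case
  proof (cases "reduced (w @ w)")
    case True
    then show ?thesis using 1 by (intro exI[of _ "[]"] exI[of _ w]) (simp add: inv_word_def)
  next
    case False
    then have h: "hd w = inv_letter (last w)" using 1 by (simp add: reduced_append)
    obtain x v where w: "w = x # v" using 1 by (cases w) auto
    have "v \<noteq> []" using h w by auto
    then obtain u y where v: "v = u @ [y]" by (cases v rule: rev_cases) auto
    have y: "y = inv_letter x" using h w v by auto
    have "u \<noteq> []" using 1 w v y by (auto simp: reduced_Cons)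
    moreover have "reduced u" using 1 w v by (simp add: reduced_Cons reduced_append)
    moreover have "length u < length w" using w v by simp
    ultimately obtain g c where "u = g @ c @ inv_word g" "c \<noteq> []" "reduced (c @ c)"
      using "1.IH" by blast
    then show ?thesis using w v y
      by (intro exI[of _ "x # g"] exI[of _ c]) (simp add: inv_word_def)
  qed
qed

lemma reduced_concat_replicate:
  assumes "reduced (c @ c)" shows "reduced (concat (replicate n c))"
proof (cases "c = []")
  case False
  show ?thesis
  proof (induction n)
    case (Suc n)
    then show ?case using assms False by (cases n) (simp_all add: reduced_append)
  qed simp
qed simp

lemma concat_replicate_nth:
  "i < n * length c \<Longrightarrow> concat (replicate n c) ! i = c ! (i mod length c)"
proof (induction n arbitrary: i)
  case (Suc n)
  then show ?case by (auto simp: nth_append le_mod_geq)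
qed simp

text \<open>Inner conjugators cancel, and cyclic reducedness prevents any cancellation between
  copies of \<open>c\<close> or with the outer conjugators. For \<open>n = 0\<close> the right side
  would be \<open>g @ inv_word g\<close>, which is reduced only for empty \<open>g\<close>.\<close>

lemma conj_pow:
  assumes w: "w \<in> carrier (free_group A)" "w = g @ c @ inv_word g"
    and c: "c \<noteq> []" "reduced (c @ c)" and n: "n \<ge> 1"
  shows "w [^]\<^bsub>free_group A\<^esub> (n::nat) = g @ concat (replicate n c) @ inv_word g"
proof -
  interpret group "free_group A" by (rule free_group_group)
  let ?C = "\<lambda>n. concat (replicate n c)"
  have red: "reduced (g @ c @ inv_word g)" "set (g @ c @ inv_word g) \<subseteq> A \<times> UNIV"
    using w by (auto simp: free_group_def)
  have car: "g \<in> carrier (free_group A)" "c \<in> carrier (free_group A)"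
    using red by (auto simp: free_group_def reduced_append)
  have pow: "c [^]\<^bsub>free_group A\<^esub> n = ?C n" for n :: nat
  proof (induction n)
    case 0
    then show ?case by (simp add: free_group_def)
  next
    case (Suc n)
    have "c [^]\<^bsub>free_group A\<^esub> Suc n = c \<otimes>\<^bsub>free_group A\<^esub> ?C n"
      unfolding nat_pow_Suc2[OF car(2)] Suc ..
    also have "\<dots> = c @ ?C n"
      using reduced_concat_replicate[OF c(2), of "Suc n"] by (intro mult_reduced) simp
    finally show ?case by simp
  qed
  have ends: "hd (?C n) = hd c" "last (?C n) = last c" "?C n \<noteq> []" if "n \<ge> 1" for n
    using that
  proof (induction n rule: dec_induct)
    case (step n)
    then show "hd (?C (Suc n)) = hd c" "last (?C (Suc n)) = last c" "?C (Suc n) \<noteq> []" using c(1) by auto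
  qed (use c in auto)
  have "reduced (g @ ?C n @ inv_word g)" if "n \<ge> 1" for n
    using red(1) reduced_concat_replicate[OF c(2), of n] ends[OF that] c(1)
    by (auto simp: reduced_append)
  then have prod: "g \<otimes>\<^bsub>free_group A\<^esub> (?C n \<otimes>\<^bsub>free_group A\<^esub> inv_word g) = g @ ?C n @ inv_word g"
    if "n \<ge> 1" for n using that by (simp add: mult_reduced reduced_append)
  have conj: "(g \<otimes>\<^bsub>free_group A\<^esub> (c \<otimes>\<^bsub>free_group A\<^esub> inv\<^bsub>free_group A\<^esub> g)) [^]\<^bsub>free_group A\<^esub> n =
      g \<otimes>\<^bsub>free_group A\<^esub> (c [^]\<^bsub>free_group A\<^esub> n \<otimes>\<^bsub>free_group A\<^esub> inv\<^bsub>free_group A\<^esub> g)" for n :: nat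
  proof (induction n)
    case (Suc n)
    have "inv\<^bsub>free_group A\<^esub> g \<otimes>\<^bsub>free_group A\<^esub> (g \<otimes>\<^bsub>free_group A\<^esub> x) = x"
      if "x \<in> carrier (free_group A)" for x
      using m_assoc[of "inv\<^bsub>free_group A\<^esub> g" g x] that car by simp
    then show ?case using Suc car by (simp add: m_assoc)
  qed (use car in simp)
  have "w = g \<otimes>\<^bsub>free_group A\<^esub> (c \<otimes>\<^bsub>free_group A\<^esub> inv\<^bsub>free_group A\<^esub> g)"
    using prod[of 1] w(2) inv_free_group[OF car(1)] by simp
  then have "w [^]\<^bsub>free_group A\<^esub> n = g \<otimes>\<^bsub>free_group A\<^esub> (?C n \<otimes>\<^bsub>free_group A\<^esub> inv_word g)"
    using conj[of n] pow inv_free_group[OF car(1)] by simp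
  then show ?thesis using prod[OF n] by simp
qed

section \<open>Limits of powers and axes of group elements\<close>

lemma converges_to_bd_boundary:
  assumes "converges_to_bd u X" "\<And>n. u n \<in> carrier (free_group A)"
  shows "X \<in> boundary A"
proof -
  have "X i \<in> A \<times> UNIV \<and> X (Suc i) \<noteq> inv_letter (X i)" for i
  proof -
    obtain n where n: "take (Suc (Suc i)) (u n) = prefix_word (Suc (Suc i)) X"
      using assms(1) unfolding converges_to_bd_def by (meson eventually_sequentially order_refl)
    have "length (take (Suc (Suc i)) (u n)) = Suc (Suc i)" unfolding n by (simp add: prefix_word_def)
    then have len: "Suc i < length (u n)" by simp
    have "u n ! j = X j" if "j < Suc (Suc i)" for j
      using arg_cong[OF n, of "\<lambda>l. l ! j"] that by (simp add: prefix_word_def del: upt_Suc take_Suc)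
    then have "u n ! i = X i" "u n ! Suc i = X (Suc i)" by auto
    moreover have "reduced (u n)" "set (u n) \<subseteq> A \<times> UNIV" using assms(2)[of n] by (auto simp: free_group_def)
    ultimately show ?thesis using len nth_mem[of i "u n"]
      unfolding reduced_def successively_conv_nth by (metis Suc_lessD subsetD)
  qed
  then show ?thesis by (simp add: boundary_def del: mem_Sigma_iff)
qed

lemma bd_limit_eqI:
  assumes "converges_to_bd u X" "\<And>n. u n \<in> carrier (free_group A)"
  shows "bd_limit A u = X"
  unfolding bd_limit_def
proof (rule the_equality)
  show "X \<in> boundary A \<and> converges_to_bd u X" using assms converges_to_bd_boundary by blast
  fix Y assume Y: "Y \<in> boundary A \<and> converges_to_bd u Y"
  have "prefix_word k Y = prefix_word k X" for k
  proof -
    have "\<forall>\<^sub>F n in sequentially. take k (u n) = prefix_word k X \<and> take k (u n) = prefix_word k Y"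
      using assms(1) Y unfolding converges_to_bd_def by (simp add: eventually_conj)
    then show ?thesis by (auto simp: eventually_sequentially)
  qed
  then show "Y = X" unfolding prefix_word_eq_iff by (meson ext lessI)
qed

lemma conj_pow_converges:
  assumes w: "w \<in> carrier (free_group A)" "w = g @ c @ inv_word g"
    and c: "c \<noteq> []" "reduced (c @ c)"
  shows "converges_to_bd (\<lambda>n. w [^]\<^bsub>free_group A\<^esub> n) (prepend g (\<lambda>i. periodic c (int i)))"
  unfolding converges_to_bd_def
proof
  fix k
  \<comment> \<open>With \<open>Suc k\<close> copies of the non-empty word \<open>c\<close>, the
    first \<open>k\<close> letters never reach the final \<open>inv_word g\<close>; moreover
    \<open>n \<ge> 1\<close>, as the formula for powers demands.\<close>
  have "take k (w [^]\<^bsub>free_group A\<^esub> n) = prefix_word k (prepend g (\<lambda>i. periodic c (int i)))"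
    if n: "n \<ge> Suc k" for n
  proof (rule nth_equalityI)
    have "n \<le> n * length c" using c(1) by (cases c) auto
    then have "k \<le> n * length c" using n by linarith
    then have len: "k \<le> length (concat (replicate n c))" by (simp add: length_concat sum_list_replicate)
    have p: "w [^]\<^bsub>free_group A\<^esub> n = g @ concat (replicate n c) @ inv_word g"
      using conj_pow[OF w c, of n] n by simp
    show "length (take k (w [^]\<^bsub>free_group A\<^esub> n)) =
        length (prefix_word k (prepend g (\<lambda>i. periodic c (int i))))"
      unfolding p using len by (simp add: prefix_word_def)
    fix i assume "i < length (take k (w [^]\<^bsub>free_group A\<^esub> n))"
    then have i: "i < k" by simp
    have "concat (replicate n c) ! j = periodic c (int j)" if "j < k" for j
      using concat_replicate_nth[of j n c] that n \<open>n \<le> n * length c\<close>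
      unfolding periodic_def zmod_int[symmetric] nat_int by simp
    then show "take k (w [^]\<^bsub>free_group A\<^esub> n) ! i =
        prefix_word k (prepend g (\<lambda>i. periodic c (int i))) ! i"
      unfolding p using i len by (auto simp: prefix_word_def nth_append prepend_nth)
  qed
  then show "\<forall>\<^sub>F n in sequentially. take k (w [^]\<^bsub>free_group A\<^esub> n) =
      prefix_word k (prepend g (\<lambda>i. periodic c (int i)))"
    unfolding eventually_sequentially by blast
qed

lemma periodic_inv_word:
  assumes "c \<noteq> []"
  shows "periodic (inv_word c) i = inv_letter (periodic c (- 1 - i))"
proof -
  let ?p = "int (length c)"
  define r where "r = nat (i mod ?p)"
  have r: "r < length c" "int r = i mod ?p" using assms by (simp_all add: r_def nat_less_iff)
  have "(- 1 - i) mod ?p = (- 1 - int r) mod ?p" unfolding r by (simp add: mod_simps)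
  also have "\<dots> = (- 1 - int r + ?p) mod ?p" by simp
  also have "\<dots> = int (length c - Suc r)" using r(1) by (subst mod_pos_pos_trivial) auto
  finally have "periodic c (- 1 - i) = c ! (length c - Suc r)" by (simp add: periodic_def)
  moreover have "periodic (inv_word c) i = inv_letter (c ! (length c - Suc r))"
    using r by (simp add: periodic_def inv_word_def rev_nth r_def[symmetric])
  ultimately show ?thesis by simp
qed

text \<open>The axis of \<open>c\<close> passes through \<open>1\<close> and reads
  \<open>periodic c\<close>; conjugation by \<open>g\<close> translates it. The negative end is the
  positive end of the inverse word, which has the same conjugator \<open>g\<close>.\<close>

lemma ends_eq_leaf:
  assumes w: "w \<in> carrier (free_group A)" "w = g @ c @ inv_word g"
    and c: "c \<noteq> []" "reduced (c @ c)"
  shows "(neg_end A w, pos_end A w) = act2 g (leaf (periodic c))"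
proof -
  interpret group "free_group A" by (rule free_group_group)
  have inv: "inv_word w \<in> carrier (free_group A)" "inv_word w = g @ inv_word c @ inv_word g"
    using inv_word_carrier[OF w(1)] w(2) by (simp_all add: inv_word_def rev_map comp_def)
  have c': "inv_word c \<noteq> []" "reduced (inv_word c @ inv_word c)"
    using c(1) reduced_inv_word[OF c(2)] by (simp_all add: inv_word_def)
  note lim = conj_pow_converges[OF w c] conj_pow_converges[OF inv c']
  have "w [^]\<^bsub>free_group A\<^esub> (- int n) = inv_word w [^]\<^bsub>free_group A\<^esub> n" for n
    using int_pow_neg_int[OF w(1)] nat_pow_inv[OF w(1)] inv_free_group[OF w(1)] by simp
  then have neg: "neg_end A w = prepend g (\<lambda>i. periodic (inv_word c) (int i))"
    unfolding neg_end_def using bd_limit_eqI[OF lim(2)] inv(1) by simp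
  have pos: "pos_end A w = prepend g (\<lambda>i. periodic c (int i))"
    unfolding pos_end_def int_pow_int using bd_limit_eqI[OF lim(1)] w(1) by simp
  have "(\<lambda>i. periodic (inv_word c) (int i)) = fst (leaf (periodic c))"
    using periodic_inv_word[OF c(1)] by (simp add: leaf_def)
  moreover have "act g (\<lambda>i. periodic c (int i)) = prepend g (\<lambda>i. periodic c (int i))"
    by (rule prepend_eq_act[of g _ A, OF converges_to_bd_boundary[OF lim(1)]]) (use w(1) in simp_all)
  moreover have "act g (\<lambda>i. periodic (inv_word c) (int i)) = prepend g (\<lambda>i. periodic (inv_word c) (int i))"
    by (rule prepend_eq_act[of g _ A, OF converges_to_bd_boundary[OF lim(2)]]) (use inv(1) in simp_all)
  ultimately show ?thesis unfolding neg pos by (simp add: act2_def prod_eq_iff leaf_def)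
qed

text \<open>Right multiplication by \<open>g\<close> permutes the group, so the conjugator
  disappears. Shifts of the periodic word are absorbed by the action, and its reversal accounts for
  the flipped half of \<open>lam_of\<close>.\<close>

lemma lam_of_eq_orbit:
  assumes w: "w \<in> carrier (free_group A)" "w = g @ c @ inv_word g"
    and c: "c \<noteq> []" "reduced (c @ c)"
  shows "lam_of A w = orbit A (periodic_subshift c)"
proof -
  interpret group "free_group A" by (rule free_group_group)
  let ?G = "carrier (free_group A)"
  define P where "P = periodic c"
  have car: "g \<in> ?G" "set c \<subseteq> A \<times> UNIV" using w by (auto simp: free_group_def reduced_append)
  have P: "P \<in> biinf A" unfolding P_def by (rule periodic_biinf[OF c(1) car(2) c(2)])
  have lam: "lam_of A w = (\<lambda>v. act2 v (act2 g (leaf P))) ` ?G \<union> (\<lambda>v. prod.swap (act2 v (act2 g (leaf P)))) ` ?G"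
    unfolding lam_of_def P_def ends_eq_leaf[OF w c, symmetric] by (auto simp: act2_def)
  have mult: "act2 v (act2 g (leaf P)) = act2 (v \<otimes>\<^bsub>free_group A\<^esub> g) (leaf P)" if "v \<in> ?G" for v
    using act2_mult[OF that car(1) leaf_boundary2[OF P]] by simp
  have tr: "(\<lambda>v. v \<otimes>\<^bsub>free_group A\<^esub> g) ` ?G = ?G"
  proof
    show "?G \<subseteq> (\<lambda>v. v \<otimes>\<^bsub>free_group A\<^esub> g) ` ?G"
    proof
      fix v assume v: "v \<in> ?G"
      then have "v = (v \<otimes>\<^bsub>free_group A\<^esub> inv\<^bsub>free_group A\<^esub> g) \<otimes>\<^bsub>free_group A\<^esub> g"
        using car(1) by (simp add: m_assoc)
      then show "v \<in> (\<lambda>v. v \<otimes>\<^bsub>free_group A\<^esub> g) ` ?G" using v car(1) by blast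
    qed
  qed (use car in auto)
  have G: "(\<lambda>v. act2 v (act2 g (leaf P))) ` ?G = (\<lambda>v. act2 v (leaf P)) ` ?G"
    using mult by (subst (2) tr[symmetric]) (simp add: image_image)
  have lam': "lam_of A w = (\<lambda>v. act2 v (leaf P)) ` ?G \<union> prod.swap ` (\<lambda>v. act2 v (leaf P)) ` ?G"
    unfolding lam G[symmetric] image_image ..
  have refl: "act2 v (leaf (shift m P)) \<in> (\<lambda>v. act2 v (leaf P)) ` ?G" if "v \<in> ?G" for v m
  proof -
    obtain u where u: "u \<in> ?G" "leaf (shift m P) = act2 u (leaf P)" using leaf_shift[OF P] by blast
    have "act2 v (leaf (shift m P)) = act2 (v \<otimes>\<^bsub>free_group A\<^esub> u) (leaf P)"
      unfolding u(2) using act2_mult[OF that u(1) leaf_boundary2[OF P]] by simp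
    then show ?thesis using that u(1) by blast
  qed
  show ?thesis
  proof
    have "P \<in> periodic_subshift c" "reverse P \<in> periodic_subshift c"
      unfolding periodic_subshift_def P_def by (metis UnI1 rangeI shift_0, metis UnI2 rangeI shift_0)
    then show "lam_of A w \<subseteq> orbit A (periodic_subshift c)"
      unfolding lam' by (auto simp: swap_act2 leaf_reverse[symmetric] intro!: mem_orbitI)
    show "orbit A (periodic_subshift c) \<subseteq> lam_of A w"
    proof
      fix Q assume "Q \<in> orbit A (periodic_subshift c)"
      then obtain v m where "v \<in> ?G" "Q = act2 v (leaf (shift m P)) \<or> Q = act2 v (leaf (reverse (shift m P)))"
        by (auto simp: orbit_def periodic_subshift_def P_def)
      then show "Q \<in> lam_of A w"
        unfolding lam' using refl[of v m] by (auto simp: leaf_reverse swap_act2[symmetric])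
    qed
  qed
qed

section \<open>Approximation by rational laminations\<close>

text \<open>A leaf through \<open>1\<close> has no common prefix, so a close pair has none either
  and is itself a leaf sharing the window.\<close>

lemma hausdorff_less_agree:
  assumes L: "L \<in> algebraic_laminations A" "L' \<in> algebraic_laminations A" and k: "k \<ge> 1"
    and d: "hausdorff_dist bd2_dist L L' < exp (- real k)" and Z: "Z \<in> words_of A L"
  shows "\<exists>V\<in>words_of A L'. agree k Z V"
proof -
  have Z': "Z \<in> biinf A" "leaf Z \<in> L" using Z by (auto simp: words_of_def)
  obtain Q where Q: "Q \<in> L'" "bd2_dist (leaf Z) Q < exp (- real k)"
    using hausdorff_less_ex[OF algebraic_laminationD(2)[OF L(2)] bd2_dist_nonneg bd2_dist_le_1 d Z'(2)] by blast
  have "Q \<in> boundary2 A" using Q(1) algebraic_laminationD(1)[OF L(2)] by auto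
  then obtain V where "V \<in> biinf A" "Q = prepend2 [] (leaf V)" "agree k Z V"
    using near_decomp[OF Z'(1) _ k, of Q "[]"] Q(2) by (auto simp: prod.map_ident_strong)
  then show ?thesis using Q(1) by (auto simp: words_of_def prod.map_ident_strong)
qed

text \<open>A subshift of finite type given by its allowed transitions. The symmetry of
  \<open>E\<close> is exactly what reversal requires, and closedness holds because each condition
  involves only two neighbouring letters.\<close>

lemma subshift_of_pairs:
  assumes E: "\<And>u v. (u, v) \<in> E \<Longrightarrow> (inv_letter v, inv_letter u) \<in> E"
    and ne: "Z0 \<in> biinf A" "\<And>i. (Z0 i, Z0 (i + 1)) \<in> E"
  shows "subshift A {Z \<in> biinf A. \<forall>i. (Z i, Z (i + 1)) \<in> E}"
  unfolding subshift_def
proof (intro conjI ballI allI impI)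
  let ?S = "{Z \<in> biinf A. \<forall>i. (Z i, Z (i + 1)) \<in> E}"
  show "?S \<subseteq> biinf A" by auto
  show "?S \<noteq> {}" using ne by auto
  show "shift m Z \<in> ?S" if "Z \<in> ?S" for Z m
  proof -
    have "(Z (i + m), Z (i + 1 + m)) \<in> E" for i
      using that by (simp add: add.commute[of _ m] add.assoc[symmetric])
    then show ?thesis using that shift_biinf by (auto simp: shift_def)
  qed
  show "reverse Z \<in> ?S" if "Z \<in> ?S" for Z
  proof -
    have "(Z (- 1 - (i + 1)), Z (- 1 - (i + 1) + 1)) \<in> E" for i using that by blast
    then have "(reverse Z i, reverse Z (i + 1)) \<in> E" for i
      unfolding reverse_def using E by (metis diff_add_cancel diff_diff_eq)
    then show ?thesis using that reverse_biinf by auto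
  qed
  show "Z \<in> ?S" if Z: "Z \<in> biinf A" "\<forall>k. \<exists>Z'\<in>?S. agree k Z Z'" for Z
  proof -
    have "(Z i, Z (i + 1)) \<in> E" for i
    proof -
      obtain Z' where Z': "Z' \<in> ?S" "agree (Suc (nat \<bar>i\<bar> + 1)) Z Z'" using Z(2) by blast
      have "Z i = Z' i" "Z (i + 1) = Z' (i + 1)" by (rule agreeD[OF Z'(2)]; simp)+
      then show ?thesis using Z'(1) by simp
    qed
    then show ?thesis using Z(1) by simp
  qed
qed

lemma periodic_subshift_add:
  assumes "V \<in> periodic_subshift c" shows "V (i + int (length c)) = V i"
proof -
  let ?p = "int (length c)"
  consider m where "V = shift m (periodic c)" | m where "V = reverse (shift m (periodic c))"
    using assms by (auto simp: periodic_subshift_def)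
  then show ?thesis
  proof cases
    case (1 m)
    then show ?thesis using periodic_add[of c "i + m"] by (simp add: shift_def algebra_simps)
  next
    case (2 m)
    then show ?thesis
      using periodic_add[of c "- 1 - i - ?p + m"] by (simp add: reverse_def shift_def algebra_simps)
  qed
qed

text \<open>Distance below \<open>exp (-1)\<close> compares windows of two letters. A rational
  lamination that close would contain the transition from \<open>x\<close> to \<open>y\<close>,
  while all its transitions lie in a graph with no path back; periodicity forbids this.\<close>

lemma rational_not_dense:
  assumes "card A \<ge> 2"
  shows "\<exists>L\<in>algebraic_laminations A. L \<notin> (lamination_topology A) closure_of (rational_laminations A)"
proof -
  interpret M: Metric_space "algebraic_laminations A" "hausdorff_dist bd2_dist"
    by (rule Metric_space_laminations)
  obtain a b where ab: "a \<in> A" "b \<in> A" "a \<noteq> b"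
    using assms card_le_Suc0_iff_eq[of A] card_gt_0_iff[of A] by auto
  define x y where "x = (a, True)" and "y = (b, True)"
  \<comment> \<open>The transitions of the word \<open>Z0\<close> and of its reversal. The only
    letter that may follow \<open>y\<close> is \<open>y\<close> itself.\<close>
  define E where "E = {(x, x), (x, y), (y, y), (inv_letter y, inv_letter y),
    (inv_letter y, inv_letter x), (inv_letter x, inv_letter x)}"
  define Z0 where "Z0 i = (if i < 0 then x else y)" for i :: int
  define S where "S = {Z \<in> biinf A. \<forall>i. (Z i, Z (i + 1)) \<in> E}"
  have "Z0 \<in> biinf A"
    by (rule biinfI) (use ab in \<open>auto simp: Z0_def x_def y_def inv_letter_def\<close>)
  moreover have inv: "(inv_letter v, inv_letter u) \<in> E" if "(u, v) \<in> E" for u v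
    using that by (auto simp: E_def)
  moreover have Z0E: "(Z0 i, Z0 (i + 1)) \<in> E" for i by (auto simp: Z0_def E_def)
  ultimately have S: "subshift A S" and Z0: "Z0 \<in> S"
    unfolding S_def using subshift_of_pairs[of E Z0 A] inv Z0E by blast+
  let ?L = "orbit A S"
  have L: "?L \<in> algebraic_laminations A" by (rule orbit_lamination[OF S])
  have "?L \<notin> (lamination_topology A) closure_of (rational_laminations A)"
  proof
    assume "?L \<in> (lamination_topology A) closure_of (rational_laminations A)"
    then have "\<forall>r>0. \<exists>L'\<in>rational_laminations A. L' \<in> M.mball ?L r"
      unfolding lamination_topology_def M.metric_closure_of by blast
    from this[rule_format, OF exp_gt_zero, of "- real 1"]
    obtain L' where L': "L' \<in> rational_laminations A" "L' \<in> algebraic_laminations A"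
      "hausdorff_dist bd2_dist ?L L' < exp (- real 1)"
      by auto
    have d': "hausdorff_dist bd2_dist L' ?L < exp (- real 1)" using L'(3) M.commute by simp
    obtain V where V: "V \<in> words_of A L'" "agree 1 Z0 V"
      using hausdorff_less_agree[OF L L'(2) _ L'(3), of Z0] Z0 words_of_orbit[OF S] by auto
    have V0: "V (- 1) = x" "V 0 = y"
      using agreeD[OF V(2), of "- 1"] agreeD[OF V(2), of 0] by (simp_all add: Z0_def)
    have VE: "(V i, V (i + 1)) \<in> E" for i
    proof -
      \<comment> \<open>The shift brings the positions \<open>i\<close> and \<open>i + 1\<close> to
        \<open>-1\<close> and \<open>0\<close>, the window of radius \<open>1\<close>. Here the
        other half of the Hausdorff distance is used: words of \<open>L'\<close> are compared with
        words of \<open>S\<close>.\<close>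
      have "shift (i + 1) V \<in> words_of A L'" using subshiftD(3)[OF subshift_words_of(1)[OF L'(2)] V(1)] .
      then obtain U where U: "U \<in> S" "agree 1 (shift (i + 1) V) U"
        using hausdorff_less_agree[OF L'(2) L _ d'] words_of_orbit[OF S] by auto
      have "V i = U (- 1)" "V (i + 1) = U 0"
        using agreeD[OF U(2), of "- 1"] agreeD[OF U(2), of 0] by (simp_all add: shift_def)
      moreover have "(U (- 1), U (- 1 + 1)) \<in> E" using U(1) unfolding S_def by blast
      ultimately show ?thesis by simp
    qed
    have y: "V (int n) = y" for n
    proof (induction n)
      case (Suc n)
      then show ?case using VE[of "int n"] ab
        by (auto simp: E_def x_def y_def inv_letter_def add.commute)
    qed (simp add: V0)
    obtain w where w: "w \<in> carrier (free_group A)" "w \<noteq> []" "leaf V \<in> lam_of A w"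
    proof -
      obtain W where W: "L' = (\<Union>w\<in>W. lam_of A w)" "W \<subseteq> carrier (free_group A) - {\<one>\<^bsub>free_group A\<^esub>}"
        using L'(1) unfolding rational_laminations_def by blast
      then obtain w where "w \<in> W" "leaf V \<in> lam_of A w" using V(1) unfolding words_of_def by blast
      then show thesis using that[of w] W(2) by (auto simp: free_group_def)
    qed
    then obtain g c where gc: "w = g @ c @ inv_word g" "c \<noteq> []" "reduced (c @ c)"
      using conj_cyclically_reduced[of w] by (auto simp: free_group_def)
    have "set c \<subseteq> A \<times> UNIV" using w(1) gc(1) by (auto simp: free_group_def)
    then have "subshift A (periodic_subshift c)" using subshift_periodic gc by blast
    then have "words_of A (lam_of A w) = periodic_subshift c"
      unfolding lam_of_eq_orbit[OF w(1) gc] by (rule words_of_orbit)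
    then have "V \<in> periodic_subshift c" using w(3) V(1) unfolding words_of_def by blast
    \<comment> \<open>One period after the letter \<open>x\<close> at \<open>-1\<close>, the word is
      already in the half-line where it is constantly \<open>y\<close>.\<close>
    then have "V (- 1 + int (length c)) = V (- 1)"
      by (rule periodic_subshift_add)
    moreover have "- 1 + int (length c) = int (length c - 1)" using gc(2) by (cases c) auto
    ultimately have "x = y" using y[of "length c - 1"] V0(1) by metis
    then show False using ab(3) by (simp add: x_def y_def)
  qed
  then show ?thesis using L by blast
qed

text \<open>The approximating laminations have the form \<open>lam_of A c\<close> for a single
  \<open>c\<close>; no proper unions are involved.\<close>

lemma minimal_in_closure:
  assumes A: "finite A" and L: "minimal_lamination A L"
  shows "L \<in> (lamination_topology A) closure_of (rational_laminations A)"
proof -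
  interpret M: Metric_space "algebraic_laminations A" "hausdorff_dist bd2_dist"
    by (rule Metric_space_laminations)
  have LA: "L \<in> algebraic_laminations A" using L by (simp add: minimal_lamination_def)
  note W = subshift_words_of[OF LA]
  have "\<exists>L'\<in>rational_laminations A. L' \<in> M.mball L r" if "r > 0" for r
  proof -
    obtain k where k: "k \<ge> 1" "exp (- real k) < r" using exp_neg_less[OF \<open>r > 0\<close>] by blast
    obtain c where c: "c \<noteq> []" "set c \<subseteq> A \<times> UNIV" "reduced (c @ c)"
      and WP: "\<And>Z. Z \<in> words_of A L \<Longrightarrow> \<exists>V\<in>periodic_subshift c. agree k Z V"
      and PW: "\<And>V. V \<in> periodic_subshift c \<Longrightarrow> \<exists>Z\<in>words_of A L. agree k Z V"
      using minimal_subshift_periodic_approx[OF A minimal_lamination_subshift[OF L] k(1)] by metis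
    let ?L = "orbit A (periodic_subshift c)"
    have S: "subshift A (periodic_subshift c)" by (rule subshift_periodic[OF c])
    have car: "c \<in> carrier (free_group A)" using c by (simp add: free_group_def reduced_append)
    have "lam_of A c = ?L"
      by (rule lam_of_eq_orbit[of c A "[]", OF car _ c(1,3)]) (simp add: inv_word_def)
    then have "?L \<in> rational_laminations A"
      unfolding rational_laminations_def using car c(1)
      by (intro CollectI exI[of _ "{c}"]) (auto simp: free_group_def)
    moreover have "hausdorff_dist bd2_dist L ?L \<le> exp (- real k)"
      using hausdorff_orbit_le[OF W(1) S k(1) WP PW] W(2) by simp
    ultimately show ?thesis using k(2) LA orbit_lamination[OF S] by force
  qed
  then show ?thesis unfolding lamination_topology_def M.metric_closure_of using LA by auto
qed

theorem theorem1p2: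
  fixes A :: "'a set"
  assumes "finite A" and "card A \<ge> 2"
  shows "(lamination_topology A) closure_of (rational_laminations A) \<noteq> algebraic_laminations A \<and>
    {L. minimal_lamination A L} \<subseteq> (lamination_topology A) closure_of (rational_laminations A)"
  using rational_not_dense[OF assms(2)] minimal_in_closure[OF assms(1)] by blast

end
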